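(* Let $q$ be a prime, $p$ a positive integer coprime to $q$, and $\phi\in\mathbb Z$ with $\phi\not\equiv1\pmod q$ and $\phi^p\equiv1\pmod q$. Let $r$ be the smallest divisor of $p$ such that $\phi^r\equiv1\pmod q$. Let $V$ be a tame holomorphic VOA and $G<\mathrm{Aut}(V)$ a group of automorphisms isomorphic to $\mathbb Z_q\rtimes_\phi\mathbb Z_p=\langle a,A\mid a^q=A^p=1,\ AaA^{-1}=a^\phi\rangle$, and put $B=A^r$. Assume that the class $\omega\in H^3(G,U(1))$ of the orbifold is trivial. Then the character of $V^{\mathrm{orb}(G)}$ is $$\chi^{\mathrm{orb}(\mathbb Z_q\rtimes_\phi\mathbb Z_p)}(\tau)=\chi^{\mathrm{orb}(\mathbb Z_p)}(\tau)-\frac1r\Big(\chi^{\mathrm{orb}(\mathbb Z_{p/r})}(\tau)-\chi^{\mathrm{orb}(\mathbb Z_{pq/r})}(\tau)\Big),$$ where $\mathbb Z_p=\langle A\rangle$, $\mathbb Z_{p/r}=\langle B\rangle$ and $\mathbb Z_{pq/r}=\langle aB\rangle$.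
   Context: A VOA is tame if it is rational, $C_2$-cofinite, simple, self-contragredient and of CFT-type; it is holomorphic if its only irreducible module is itself. For $g\in G$ let $W_g$ be the unique irreducible $g$-twisted $V$-module. The centralizer $C_G(g)$ acts projectively on $W_g$ through maps $\phi_g(h)$, unique up to scalars, with $\phi_g(h)Y_{W}(v,x)\phi_g(h)^{-1}=Y_{W}(hv,x)$. The class $\omega\in H^3(G,U(1))$ is the one governing the fusion of the twisted modules, so that the module category of $V^G$ is that of the twisted Drinfeld double $D^\omega(G)$. When $\omega$ is trivial, one takes the representative $\omega=1$ and normalizes the $\phi_g$ accordingly so that they are linear representations of $C_G(g)$; the twining characters $T(g,h;\tau)=\mathrm{tr}_{W_g}\phi_g(h)e^{2\pi i\tau(L_0-c/24)}$ ($gh=hg$) are then invariant under simultaneous conjugation of $(g,h)$ in $G$. For a subgroup $H\le G$ (using the restricted $\phi_g$'s), the holomorphic extension of $V^H$ is $V^{\mathrm{orb}(H)}=\bigoplus_{g}W_g^{C_H(g)}$, where $g$ runs over representatives of the conjugacy classes of $H$ and $W_g^{C_H(g)}$ is the $C_H(g)$-invariant part of $W_g$; its character is $\chi^{\mathrm{orb}(H)}(\tau)=\sum_{g}\frac1{|C_H(g)|}\sum_{h\in C_H(g)}T(g,h;\tau)$. *)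

theory Defs
  imports
    "HOL-Analysis.Analysis"
    "HOL-Algebra.Generated_Groups"
    "HOL-Number_Theory.Cong"
    "HOL-Library.Function_Algebras"
    "HOL-Library.Groups_Big_Fun"
begin

section \<open>Complex vector spaces\<close>

class complex_vector = ab_group_add +
  fixes scaleC :: "complex \<Rightarrow> 'a \<Rightarrow> 'a" (infixr "*\<^sub>C" 75)
  assumes scaleC_add_right: "c *\<^sub>C (x + y) = c *\<^sub>C x + c *\<^sub>C y"
    and scaleC_add_left: "(c + d) *\<^sub>C x = c *\<^sub>C x + d *\<^sub>C x"
    and scaleC_scaleC: "c *\<^sub>C d *\<^sub>C x = (c * d) *\<^sub>C x"
    and scaleC_one: "1 *\<^sub>C x = x"

global_interpretation cvec: vector_space "scaleC :: complex \<Rightarrow> 'a \<Rightarrow> 'a::complex_vector"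
  by unfold_locales (simp_all add: scaleC_add_right scaleC_add_left scaleC_scaleC scaleC_one)

instantiation complex :: complex_vector
begin
definition scaleC_complex :: "complex \<Rightarrow> complex \<Rightarrow> complex"
  where "scaleC_complex c x = c * x"
instance by standard (simp_all add: scaleC_complex_def algebra_simps)
end

instantiation "fun" :: (type, complex_vector) complex_vector
begin
definition scaleC_fun :: "complex \<Rightarrow> ('a \<Rightarrow> 'b) \<Rightarrow> 'a \<Rightarrow> 'b"
  where "scaleC_fun c f = (\<lambda>x. c *\<^sub>C f x)"
instance
  by standard (simp_all add: scaleC_fun_def fun_eq_iff scaleC_add_right scaleC_add_left
      scaleC_scaleC scaleC_one)
end

definition clinear_on :: "'a::complex_vector set \<Rightarrow> ('a \<Rightarrow> 'b::complex_vector) \<Rightarrow> bool"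
  where "clinear_on S f \<longleftrightarrow>
    (\<forall>x\<in>S. \<forall>y\<in>S. f (x + y) = f x + f y) \<and> (\<forall>c. \<forall>x\<in>S. f (c *\<^sub>C x) = c *\<^sub>C f x)"

definition finite_dim :: "'a::complex_vector set \<Rightarrow> bool"
  where "finite_dim S \<longleftrightarrow> (\<exists>E. finite E \<and> S \<subseteq> cvec.span E)"

definition direct_sum :: "'i set \<Rightarrow> ('i \<Rightarrow> 'a::complex_vector set) \<Rightarrow> 'a set \<Rightarrow> bool"
  where "direct_sum I P C \<longleftrightarrow>
    (\<forall>i\<in>I. cvec.subspace (P i)) \<and> cvec.span (\<Union>i\<in>I. P i) = C \<and>
    (\<forall>F x. finite F \<and> F \<subseteq> I \<and> (\<forall>i\<in>F. x i \<in> P i) \<and> (\<Sum>i\<in>F. x i) = 0 \<longrightarrow> (\<forall>i\<in>F. x i = 0))"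

text \<open>Trace of an endomorphism of a finite-dimensional subspace; it does not depend on the basis.\<close>

definition ctrace :: "'a::complex_vector set \<Rightarrow> ('a \<Rightarrow> 'a) \<Rightarrow> complex"
  where "ctrace S f =
    (let E = (SOME E. E \<subseteq> S \<and> cvec.independent E \<and> cvec.span E = S)
     in \<Sum>e\<in>E. cvec.representation E (f e) e)"


section \<open>Vertex operator algebras\<close>

text \<open>The underlying vector space is the whole type. The field \<open>mode V u n\<close> is the
  coefficient \<open>u\<^sub>n\<close> in \<open>Y(u,x) = \<Sum>\<^sub>n u\<^sub>n x\<^sup>-\<^sup>n\<^sup>-\<^sup>1\<close>.
  Sums over \<open>j\<close> written with \<open>Sum_any\<close> have finite support by the truncation axioms.\<close>

record 'v voa =
  mode :: "'v \<Rightarrow> int \<Rightarrow> 'v \<Rightarrow> 'v"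
  vac :: 'v
  conf :: 'v
  cc :: complex

definition vir :: "'v voa \<Rightarrow> int \<Rightarrow> 'v \<Rightarrow> 'v"
  where "vir V m = mode V (conf V) (m + 1)"

definition voa_weight :: "'v::complex_vector voa \<Rightarrow> int \<Rightarrow> 'v set"
  where "voa_weight V n = {v. vir V 0 v = of_int n *\<^sub>C v}"

definition is_voa :: "'v::complex_vector voa \<Rightarrow> bool"
  where "is_voa V \<longleftrightarrow>
    (\<forall>n v. clinear_on UNIV (mode V v n) \<and> clinear_on UNIV (\<lambda>u. mode V u n v)) \<and>
    (\<forall>u v. \<exists>N. \<forall>n\<ge>N. mode V u n v = 0) \<and>
    (\<forall>v n. mode V (vac V) n v = (if n = -1 then v else 0)) \<and>
    (\<forall>v. mode V v (-1) (vac V) = v \<and> (\<forall>n\<ge>0. mode V v n (vac V) = 0)) \<and>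
    (\<forall>u v w l m n.
       Sum_any (\<lambda>j::nat. (of_int m gchoose j) *\<^sub>C mode V (mode V u (l + int j) v) (m + n - int j) w) =
       Sum_any (\<lambda>j::nat. ((-1) ^ j * (of_int l gchoose j)) *\<^sub>C
          (mode V u (m + l - int j) (mode V v (n + int j) w)
           - ((-1) powi l) *\<^sub>C mode V v (n + l - int j) (mode V u (m + int j) w)))) \<and>
    (\<forall>m n v. vir V m (vir V n v) - vir V n (vir V m v) =
       of_int (m - n) *\<^sub>C vir V (m + n) v
       + (if m + n = 0 then (of_int (m ^ 3 - m) / 12 * cc V) *\<^sub>C v else 0)) \<and>
    (\<forall>u n v. mode V (vir V (-1) u) n v = (- of_int n) *\<^sub>C mode V u (n - 1) v) \<and>
    direct_sum UNIV (voa_weight V) UNIV \<and>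
    (\<forall>n. finite_dim (voa_weight V n)) \<and>
    (\<exists>N. \<forall>n<N. voa_weight V n = {0})"

definition voa_aut :: "'v::complex_vector voa \<Rightarrow> ('v \<Rightarrow> 'v) set"
  where "voa_aut V = {\<sigma>. clinear_on UNIV \<sigma> \<and> bij \<sigma> \<and> \<sigma> (vac V) = vac V \<and> \<sigma> (conf V) = conf V \<and>
    (\<forall>u n v. \<sigma> (mode V u n v) = mode V (\<sigma> u) n (\<sigma> v))}"

definition Aut_group :: "'v::complex_vector voa \<Rightarrow> ('v \<Rightarrow> 'v) monoid"
  where "Aut_group V = \<lparr>carrier = voa_aut V, mult = (\<circ>), one = id\<rparr>"


section \<open>Twisted modules\<close>

text \<open>A module lives on a subspace \<open>mspace\<close> of a complex vector space; \<open>mact M u n\<close> is the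
  coefficient of \<open>x\<^sup>-\<^sup>n\<^sup>-\<^sup>1\<close> in \<open>Y\<^sub>M(u,x)\<close>, with rational \<open>n\<close>. Untwisted modules are the
  \<open>id\<close>-twisted ones.\<close>

record ('v, 'w) vmodule =
  mspace :: "'w set"
  mact :: "'v \<Rightarrow> rat \<Rightarrow> 'w \<Rightarrow> 'w"

definition eigenvec :: "('v::complex_vector \<Rightarrow> 'v) \<Rightarrow> rat \<Rightarrow> 'v \<Rightarrow> bool"
  where "eigenvec g r u \<longleftrightarrow> g u = cis (2 * pi * of_rat r) *\<^sub>C u"

text \<open>Convention: if \<open>g u = e\<^sup>2\<^sup>\<pi>\<^sup>i\<^sup>r u\<close> then \<open>Y(u,x)\<close> has exponents \<open>-n-1\<close> with
  \<open>n \<in> r + \<int>\<close>, that is \<open>Y(g u, e\<^sup>2\<^sup>\<pi>\<^sup>i x) = Y(u,x)\<close>. The identity below is the component form of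
  the twisted Jacobi identity.\<close>

definition weak_twisted_module ::
    "'v::complex_vector voa \<Rightarrow> ('v \<Rightarrow> 'v) \<Rightarrow> ('v, 'w::complex_vector) vmodule \<Rightarrow> bool"
  where "weak_twisted_module V g M \<longleftrightarrow>
    cvec.subspace (mspace M) \<and>
    (\<forall>u n. \<forall>w\<in>mspace M. mact M u n w \<in> mspace M) \<and>
    (\<forall>u n. clinear_on (mspace M) (mact M u n)) \<and>
    (\<forall>n. \<forall>w\<in>mspace M. clinear_on UNIV (\<lambda>u. mact M u n w)) \<and>
    (\<forall>u r n. \<forall>w\<in>mspace M. eigenvec g r u \<and> n - r \<notin> \<int> \<longrightarrow> mact M u n w = 0) \<and>
    (\<forall>u. \<forall>w\<in>mspace M. \<exists>N. \<forall>n\<ge>N. mact M u n w = 0) \<and>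
    (\<forall>n. \<forall>w\<in>mspace M. mact M (vac V) n w = (if n = -1 then w else 0)) \<and>
    (\<forall>u v l m n. \<forall>w\<in>mspace M. eigenvec g m u \<longrightarrow>
       Sum_any (\<lambda>j::nat. (of_rat m gchoose j) *\<^sub>C
          mact M (mode V u (l + int j) v) (m + n - of_nat j) w) =
       Sum_any (\<lambda>j::nat. ((-1) ^ j * (of_int l gchoose j)) *\<^sub>C
          (mact M u (m + of_int l - of_nat j) (mact M v (n + of_nat j) w)
           - ((-1) powi l) *\<^sub>C mact M v (n + of_int l - of_nat j) (mact M u (m + of_nat j) w))))"

definition mweight ::
    "'v voa \<Rightarrow> ('v, 'w::complex_vector) vmodule \<Rightarrow> complex \<Rightarrow> 'w set"
  where "mweight V M \<rho> = {w \<in> mspace M. mact M (conf V) 1 w = \<rho> *\<^sub>C w}"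

definition aut_order :: "('v \<Rightarrow> 'v) \<Rightarrow> nat"
  where "aut_order g = (LEAST T. 0 < T \<and> g ^^ T = id)"

definition twisted_module ::
    "'v::complex_vector voa \<Rightarrow> ('v \<Rightarrow> 'v) \<Rightarrow> ('v, 'w::complex_vector) vmodule \<Rightarrow> bool"
  where "twisted_module V g M \<longleftrightarrow>
    weak_twisted_module V g M \<and>
    direct_sum UNIV (mweight V M) (mspace M) \<and>
    (\<forall>\<rho>. finite_dim (mweight V M \<rho>)) \<and>
    (\<forall>\<rho>. \<exists>N::int. \<forall>n<N. mweight V M (\<rho> + of_int n / of_nat (aut_order g)) = {0})"

definition submodule :: "('v, 'w::complex_vector) vmodule \<Rightarrow> 'w set \<Rightarrow> bool"
  where "submodule M N \<longleftrightarrow>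
    cvec.subspace N \<and> N \<subseteq> mspace M \<and> (\<forall>u n. \<forall>w\<in>N. mact M u n w \<in> N)"

definition irreducible_module :: "('v, 'w::complex_vector) vmodule \<Rightarrow> bool"
  where "irreducible_module M \<longleftrightarrow>
    mspace M \<noteq> {0} \<and> (\<forall>N. submodule M N \<longrightarrow> N = {0} \<or> N = mspace M)"

definition irreducible_twisted_module ::
    "'v::complex_vector voa \<Rightarrow> ('v \<Rightarrow> 'v) \<Rightarrow> ('v, 'w::complex_vector) vmodule \<Rightarrow> bool"
  where "irreducible_twisted_module V g M \<longleftrightarrow> twisted_module V g M \<and> irreducible_module M"

definition module_isomorphic ::
    "('v, 'w::complex_vector) vmodule \<Rightarrow> ('v, 'x::complex_vector) vmodule \<Rightarrow> bool"
  where "module_isomorphic M M' \<longleftrightarrow>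
    (\<exists>f. clinear_on (mspace M) f \<and> bij_betw f (mspace M) (mspace M') \<and>
         (\<forall>u n. \<forall>w\<in>mspace M. f (mact M u n w) = mact M' u n (f w)))"

definition adjoint_module :: "'v::complex_vector voa \<Rightarrow> ('v, 'v) vmodule"
  where "adjoint_module V =
    \<lparr>mspace = UNIV, mact = (\<lambda>u n v. if n \<in> \<int> then mode V u \<lfloor>n\<rfloor> v else 0)\<rparr>"

definition admissible_module ::
    "'v::complex_vector voa \<Rightarrow> ('v, 'w::complex_vector) vmodule \<Rightarrow> bool"
  where "admissible_module V M \<longleftrightarrow>
    weak_twisted_module V id M \<and>
    (\<exists>P :: nat \<Rightarrow> 'w set. direct_sum UNIV P (mspace M) \<and>
      (\<forall>k n d u w. u \<in> voa_weight V k \<and> w \<in> P d \<longrightarrow>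
         (if int d + k - n - 1 \<ge> 0 then mact M u (of_int n) w \<in> P (nat (int d + k - n - 1))
          else mact M u (of_int n) w = 0)))"


section \<open>Tame holomorphic vertex operator algebras\<close>

text \<open>A vertex operator algebra has countable dimension, hence so has every module generated by
  one vector. Irreducible modules, and complete reducibility (which may be tested on cyclic
  modules), are therefore seen by the modules carried by subspaces of \<open>nat \<Rightarrow> complex\<close>.\<close>

definition rational_voa :: "'v::complex_vector voa \<Rightarrow> bool"
  where "rational_voa V \<longleftrightarrow>
    (\<forall>M :: ('v, nat \<Rightarrow> complex) vmodule. admissible_module V M \<longrightarrow>
      (\<exists>S. (\<forall>N\<in>S. submodule M N \<and> irreducible_module (M\<lparr>mspace := N\<rparr>)) \<and>
           direct_sum S (\<lambda>N. N) (mspace M)))"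

definition C2_cofinite :: "'v::complex_vector voa \<Rightarrow> bool"
  where "C2_cofinite V \<longleftrightarrow>
    (\<exists>E. finite E \<and> cvec.span ({mode V u (-2) v | u v. True} \<union> E) = UNIV)"

definition simple_voa :: "'v::complex_vector voa \<Rightarrow> bool"
  where "simple_voa V \<longleftrightarrow> irreducible_module (adjoint_module V)"

definition CFT_type :: "'v::complex_vector voa \<Rightarrow> bool"
  where "CFT_type V \<longleftrightarrow> (\<forall>n<0. voa_weight V n = {0}) \<and> voa_weight V 0 = cvec.span {vac V}"

definition weight_component :: "'v::complex_vector voa \<Rightarrow> int \<Rightarrow> 'v \<Rightarrow> 'v"
  where "weight_component V k v =
    (THE x. x \<in> voa_weight V k \<and> v - x \<in> cvec.span (\<Union>i\<in>-{k}. voa_weight V i))"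

text \<open>The action on the restricted dual is
  \<open>(Y'(v,x) f)(w) = f (Y(e\<^sup>x\<^sup>L\<^sup>(\<^sup>1\<^sup>) (-x\<^sup>-\<^sup>2)\<^sup>L\<^sup>(\<^sup>0\<^sup>) v, x\<^sup>-\<^sup>1) w)\<close>. For \<open>v\<close> of weight \<open>k\<close> the coefficient of
  \<open>x\<^sup>-\<^sup>n\<^sup>-\<^sup>1\<close> is \<open>(-1)\<^sup>k \<Sum>\<^sub>j (1/j!) f ((L(1)\<^sup>j v)\<^sub>m w)\<close> with \<open>m = 2 k - n - j - 2\<close>.\<close>

definition contragredient_module :: "'v::complex_vector voa \<Rightarrow> ('v, 'v \<Rightarrow> complex) vmodule"
  where "contragredient_module V =
    \<lparr>mspace = {f. clinear_on UNIV f \<and> finite {n. \<exists>v\<in>voa_weight V n. f v \<noteq> 0}},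
     mact = (\<lambda>v n f. if n \<in> \<int> then
       (\<lambda>w. Sum_any (\<lambda>k::int. Sum_any (\<lambda>j::nat. (-1) powi k / fact j *
          f (mode V ((vir V 1 ^^ j) (weight_component V k v)) (2 * k - \<lfloor>n\<rfloor> - int j - 2) w))))
       else 0)\<rparr>"

definition self_contragredient :: "'v::complex_vector voa \<Rightarrow> bool"
  where "self_contragredient V \<longleftrightarrow>
    module_isomorphic (adjoint_module V) (contragredient_module V)"

definition tame :: "'v::complex_vector voa \<Rightarrow> bool"
  where "tame V \<longleftrightarrow> is_voa V \<and> rational_voa V \<and> C2_cofinite V \<and> simple_voa V \<and>
    self_contragredient V \<and> CFT_type V"

definition holomorphic_voa :: "'v::complex_vector voa \<Rightarrow> bool"
  where "holomorphic_voa V \<longleftrightarrow>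
    irreducible_twisted_module V id (adjoint_module V) \<and>
    (\<forall>M :: ('v, nat \<Rightarrow> complex) vmodule.
       irreducible_twisted_module V id M \<longrightarrow> module_isomorphic M (adjoint_module V))"


section \<open>Fusion of twisted modules and the class in \<open>H\<^sup>3(G,U(1))\<close>\<close>

definition restricted_dual ::
    "'v voa \<Rightarrow> ('v, 'w::complex_vector) vmodule \<Rightarrow> ('w \<Rightarrow> complex) set"
  where "restricted_dual V M =
    {f. clinear_on (mspace M) f \<and> finite {\<rho>. \<exists>w\<in>mweight V M \<rho>. f w \<noteq> 0}}"

text \<open>Intertwining operators \<open>\<Y>(w\<^sub>1,x) w\<^sub>2 = \<Sum>\<^sub>n I w\<^sub>1 n w\<^sub>2 x\<^sup>-\<^sup>n\<^sup>-\<^sup>1\<close> (with \<open>n\<close> complex) from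
  \<open>M\<^sub>1\<close>, \<open>M\<^sub>2\<close> to \<open>M\<^sub>3\<close>, where \<open>M\<^sub>1\<close> is \<open>g\<close>-twisted. Fix \<open>y > 0\<close>. On the real intervals \<open>x > y\<close>,
  \<open>y < x < 2 y\<close> and \<open>0 < x < y\<close>, with real logarithms, the matrix coefficients of
  \<open>Y(u,x) \<Y>(w\<^sub>1,y)\<close>, \<open>\<Y>(Y(u,x-y) w\<^sub>1, y)\<close> and \<open>\<Y>(w\<^sub>1,y) Y(u,x)\<close> are given by the same analytic
  function, continued around \<open>x = y\<close> through the lower half plane; through the upper half plane
  the last product becomes \<open>\<Y>(w\<^sub>1,y) Y(g\<^sup>-\<^sup>1 u,x)\<close>, in accordance with the monodromy of
  \<open>Y(u,x-y) w\<^sub>1\<close>. If \<open>M\<^sub>2\<close> is \<open>h\<close>-twisted, comparing the loop around \<open>0\<close> and \<open>y\<close> with the product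
  of the loops around \<open>y\<close> and \<open>0\<close> shows that \<open>M\<^sub>3\<close> is \<open>g h\<close>-twisted with these choices.\<close>

definition slit_plane :: "real \<Rightarrow> complex set"
  where "slit_plane y = {z. Im z = 0 \<longrightarrow> 0 < Re z \<and> Re z \<noteq> y}"

definition twisted_intertwining ::
    "'v::complex_vector voa \<Rightarrow> ('v \<Rightarrow> 'v) \<Rightarrow> ('v, 'w::complex_vector) vmodule \<Rightarrow>
     ('v, 'w) vmodule \<Rightarrow> ('v, 'w) vmodule \<Rightarrow> ('w \<Rightarrow> complex \<Rightarrow> 'w \<Rightarrow> 'w) \<Rightarrow> bool"
  where "twisted_intertwining V g M\<^sub>1 M\<^sub>2 M\<^sub>3 I \<longleftrightarrow>
    (\<forall>n. \<forall>w\<^sub>1\<in>mspace M\<^sub>1. \<forall>w\<^sub>2\<in>mspace M\<^sub>2. I w\<^sub>1 n w\<^sub>2 \<in> mspace M\<^sub>3) \<and>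
    (\<forall>n. \<forall>w\<^sub>1\<in>mspace M\<^sub>1. clinear_on (mspace M\<^sub>2) (I w\<^sub>1 n)) \<and>
    (\<forall>n. \<forall>w\<^sub>2\<in>mspace M\<^sub>2. clinear_on (mspace M\<^sub>1) (\<lambda>w\<^sub>1. I w\<^sub>1 n w\<^sub>2)) \<and>
    (\<forall>n. \<forall>w\<^sub>1\<in>mspace M\<^sub>1. \<forall>w\<^sub>2\<in>mspace M\<^sub>2. \<exists>N::nat. \<forall>k\<ge>N. I w\<^sub>1 (n + of_nat k) w\<^sub>2 = 0) \<and>
    (\<forall>n. \<forall>w\<^sub>1\<in>mspace M\<^sub>1. \<forall>w\<^sub>2\<in>mspace M\<^sub>2.
       I (mact M\<^sub>1 (conf V) 0 w\<^sub>1) n w\<^sub>2 = (- n) *\<^sub>C I w\<^sub>1 (n - 1) w\<^sub>2) \<and>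
    (\<forall>u. \<forall>w\<^sub>1\<in>mspace M\<^sub>1. \<forall>w\<^sub>2\<in>mspace M\<^sub>2. \<forall>f\<in>restricted_dual V M\<^sub>3. \<forall>y::real. 0 < y \<longrightarrow>
      (\<exists>Fl Fu.
        continuous_on (slit_plane y \<inter> {z. Im z \<le> 0}) Fl \<and> Fl holomorphic_on {z. Im z < 0} \<and>
        continuous_on (slit_plane y \<inter> {z. Im z \<ge> 0}) Fu \<and> Fu holomorphic_on {z. Im z > 0} \<and>
        (\<forall>x::real. y < x \<longrightarrow>
          Fu (of_real x) = Fl (of_real x) \<and>
          ((\<lambda>(n::rat, m::complex). f (mact M\<^sub>3 u n (I w\<^sub>1 m w\<^sub>2)) *
              of_real x powr (- of_rat n - 1) * of_real y powr (- m - 1))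
            has_sum Fl (of_real x)) UNIV) \<and>
        (\<forall>x::real. y < x \<and> x < 2 * y \<longrightarrow>
          ((\<lambda>(n::rat, m::complex). f (I (mact M\<^sub>1 u n w\<^sub>1) m w\<^sub>2) *
              of_real (x - y) powr (- of_rat n - 1) * of_real y powr (- m - 1))
            has_sum Fl (of_real x)) UNIV) \<and>
        (\<forall>x::real. 0 < x \<and> x < y \<longrightarrow>
          ((\<lambda>(n::rat, m::complex). f (I w\<^sub>1 m (mact M\<^sub>2 u n w\<^sub>2)) *
              of_real x powr (- of_rat n - 1) * of_real y powr (- m - 1))
            has_sum Fl (of_real x)) UNIV \<and>
          ((\<lambda>(n::rat, m::complex). f (I w\<^sub>1 m (mact M\<^sub>2 (inv_into UNIV g u) n w\<^sub>2)) *
              of_real x powr (- of_rat n - 1) * of_real y powr (- m - 1))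
            has_sum Fu (of_real x)) UNIV)))"

text \<open>\<open>I g h\<close> is a nonzero intertwining operator from \<open>W\<^sub>g\<close>, \<open>W\<^sub>h\<close> to \<open>W\<^sub>g\<^sub>h\<close>, unique up to a
  scalar. Associativity holds up to the scalars \<open>\<omega> g h k\<close>:
  \<open>\<Y>(w\<^sub>1,x) \<Y>(w\<^sub>2,y) w\<^sub>3 = \<omega>(g,h,k) \<Y>(\<Y>(w\<^sub>1,x-y) w\<^sub>2, y) w\<^sub>3\<close> for \<open>x > y > x - y > 0\<close>.
  Rescaling the \<open>I g h\<close> changes \<open>\<omega>\<close> by a coboundary.\<close>

definition fusion_system ::
    "'v::complex_vector voa \<Rightarrow> ('v \<Rightarrow> 'v) set \<Rightarrow>
     (('v \<Rightarrow> 'v) \<Rightarrow> ('v, 'w::complex_vector) vmodule) \<Rightarrow>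
     (('v \<Rightarrow> 'v) \<Rightarrow> ('v \<Rightarrow> 'v) \<Rightarrow> ('v \<Rightarrow> 'v) \<Rightarrow> complex) \<Rightarrow>
     (('v \<Rightarrow> 'v) \<Rightarrow> ('v \<Rightarrow> 'v) \<Rightarrow> 'w \<Rightarrow> complex \<Rightarrow> 'w \<Rightarrow> 'w) \<Rightarrow> bool"
  where "fusion_system V G W \<omega> I \<longleftrightarrow>
    (\<forall>g\<in>G. \<forall>h\<in>G.
       twisted_intertwining V g (W g) (W h) (W (g \<circ> h)) (I g h) \<and>
       (\<exists>w\<^sub>1\<in>mspace (W g). \<exists>w\<^sub>2\<in>mspace (W h). \<exists>n. I g h w\<^sub>1 n w\<^sub>2 \<noteq> 0)) \<and>
    (\<forall>g\<in>G. \<forall>h\<in>G. \<forall>k\<in>G. norm (\<omega> g h k) = 1 \<and>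
      (\<forall>w\<^sub>1\<in>mspace (W g). \<forall>w\<^sub>2\<in>mspace (W h). \<forall>w\<^sub>3\<in>mspace (W k).
       \<forall>f\<in>restricted_dual V (W (g \<circ> h \<circ> k)). \<forall>x y::real. 0 < x - y \<and> x - y < y \<longrightarrow>
        (\<exists>s.
          ((\<lambda>(m::complex, n::complex). f (I g (h \<circ> k) w\<^sub>1 m (I h k w\<^sub>2 n w\<^sub>3)) *
              of_real x powr (- m - 1) * of_real y powr (- n - 1))
            has_sum (\<omega> g h k * s)) UNIV \<and>
          ((\<lambda>(m::complex, n::complex). f (I (g \<circ> h) k (I g h w\<^sub>1 m w\<^sub>2) n w\<^sub>3) *
              of_real (x - y) powr (- m - 1) * of_real y powr (- n - 1))
            has_sum s) UNIV)))"

definition orbifold_cocycle ::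
    "'v::complex_vector voa \<Rightarrow> ('v \<Rightarrow> 'v) set \<Rightarrow>
     (('v \<Rightarrow> 'v) \<Rightarrow> ('v, 'w::complex_vector) vmodule) \<Rightarrow>
     (('v \<Rightarrow> 'v) \<Rightarrow> ('v \<Rightarrow> 'v) \<Rightarrow> ('v \<Rightarrow> 'v) \<Rightarrow> complex) \<Rightarrow> bool"
  where "orbifold_cocycle V G W \<omega> \<longleftrightarrow> (\<exists>I. fusion_system V G W \<omega> I)"

definition trivial_class ::
    "('v \<Rightarrow> 'v) set \<Rightarrow> (('v \<Rightarrow> 'v) \<Rightarrow> ('v \<Rightarrow> 'v) \<Rightarrow> ('v \<Rightarrow> 'v) \<Rightarrow> complex) \<Rightarrow> bool"
  where "trivial_class G \<omega> \<longleftrightarrow>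
    (\<exists>\<mu>. (\<forall>g\<in>G. \<forall>h\<in>G. norm (\<mu> g h) = (1::real)) \<and>
         (\<forall>g\<in>G. \<forall>h\<in>G. \<forall>k\<in>G.
            \<omega> g h k = \<mu> h k * \<mu> g (h \<circ> k) / (\<mu> (g \<circ> h) k * \<mu> g h)))"


section \<open>The action on the twisted modules\<close>

definition conj_by :: "('v \<Rightarrow> 'v) \<Rightarrow> ('v \<Rightarrow> 'v) \<Rightarrow> 'v \<Rightarrow> 'v"
  where "conj_by k g = k \<circ> g \<circ> inv_into UNIV k"

definition centralizer :: "('v \<Rightarrow> 'v) set \<Rightarrow> ('v \<Rightarrow> 'v) \<Rightarrow> ('v \<Rightarrow> 'v) set"
  where "centralizer H g = {h\<in>H. h \<circ> g = g \<circ> h}"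

text \<open>\<open>\<Phi> g k : W\<^sub>g \<rightarrow> W\<^sub>k\<^sub>g\<^sub>k\<^sup>-\<^sup>1\<close>; for \<open>k\<close> in the centralizer of \<open>g\<close> this is \<open>\<phi>\<^sub>g(k)\<close>.\<close>

definition twist_action ::
    "('v \<Rightarrow> 'v) set \<Rightarrow> (('v \<Rightarrow> 'v) \<Rightarrow> ('v, 'w::complex_vector) vmodule) \<Rightarrow>
     (('v \<Rightarrow> 'v) \<Rightarrow> ('v \<Rightarrow> 'v) \<Rightarrow> 'w \<Rightarrow> 'w) \<Rightarrow> bool"
  where "twist_action G W \<Phi> \<longleftrightarrow> (\<forall>g\<in>G. \<forall>k\<in>G.
    clinear_on (mspace (W g)) (\<Phi> g k) \<and>
    bij_betw (\<Phi> g k) (mspace (W g)) (mspace (W (conj_by k g))) \<and>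
    (\<forall>v n. \<forall>w\<in>mspace (W g).
       \<Phi> g k (mact (W g) v n w) = mact (W (conj_by k g)) (k v) n (\<Phi> g k w)))"

text \<open>The scalars in \<open>\<Phi>\<close> are fixed by the fusion system through
  \<open>\<Y>\<^sub>k\<^sub>,\<^sub>g(w\<^sub>1,x) w\<^sub>2 = e\<^sup>x\<^sup>L\<^sup>(\<^sup>-\<^sup>1\<^sup>) \<Y>\<^sub>k\<^sub>g\<^sub>k\<^sup>-\<^sup>1\<^sub>,\<^sub>k(\<Phi>\<^sub>g(k) w\<^sub>2, e\<^sup>\<pi>\<^sup>i x) w\<^sub>1\<close>, stated in components.\<close>

definition braiding_normalized ::
    "'v::complex_vector voa \<Rightarrow> ('v \<Rightarrow> 'v) set \<Rightarrow>
     (('v \<Rightarrow> 'v) \<Rightarrow> ('v, 'w::complex_vector) vmodule) \<Rightarrow>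
     (('v \<Rightarrow> 'v) \<Rightarrow> ('v \<Rightarrow> 'v) \<Rightarrow> 'w \<Rightarrow> complex \<Rightarrow> 'w \<Rightarrow> 'w) \<Rightarrow>
     (('v \<Rightarrow> 'v) \<Rightarrow> ('v \<Rightarrow> 'v) \<Rightarrow> 'w \<Rightarrow> 'w) \<Rightarrow> bool"
  where "braiding_normalized V G W I \<Phi> \<longleftrightarrow>
    (\<forall>g\<in>G. \<forall>k\<in>G. \<forall>w\<^sub>1\<in>mspace (W k). \<forall>w\<^sub>2\<in>mspace (W g). \<forall>n.
       I k g w\<^sub>1 n w\<^sub>2 = Sum_any (\<lambda>i::nat.
         (exp (- (\<i> * of_real pi * (n + of_nat i + 1))) / fact i) *\<^sub>C
         (mact (W (k \<circ> g)) (conf V) 0 ^^ i) (I (conj_by k g) k (\<Phi> g k w\<^sub>2) (n + of_nat i) w\<^sub>1)))"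

text \<open>For a general representative \<open>\<omega>\<close> the composition law below holds up to the cocycle
  of the twisted double \<open>D\<^sup>\<omega>(G)\<close>, which is identically 1 for the representative \<open>\<omega> = 1\<close>. For
  \<open>k\<close>, \<open>l\<close> in the centralizer of \<open>g\<close> it says that \<open>\<phi>\<^sub>g\<close> is a linear representation.\<close>

definition linear_action ::
    "('v \<Rightarrow> 'v) set \<Rightarrow> (('v \<Rightarrow> 'v) \<Rightarrow> ('v, 'w::complex_vector) vmodule) \<Rightarrow>
     (('v \<Rightarrow> 'v) \<Rightarrow> ('v \<Rightarrow> 'v) \<Rightarrow> 'w \<Rightarrow> 'w) \<Rightarrow> bool"
  where "linear_action G W \<Phi> \<longleftrightarrow>
    (\<forall>g\<in>G. \<forall>k\<in>G. \<forall>l\<in>G. \<forall>w\<in>mspace (W g). \<Phi> (conj_by k g) l (\<Phi> g k w) = \<Phi> g (l \<circ> k) w)"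


section \<open>Twining characters and orbifolds\<close>

definition twining_character ::
    "'v::complex_vector voa \<Rightarrow> (('v \<Rightarrow> 'v) \<Rightarrow> ('v, 'w::complex_vector) vmodule) \<Rightarrow>
     (('v \<Rightarrow> 'v) \<Rightarrow> ('v \<Rightarrow> 'v) \<Rightarrow> 'w \<Rightarrow> 'w) \<Rightarrow> ('v \<Rightarrow> 'v) \<Rightarrow> ('v \<Rightarrow> 'v) \<Rightarrow> complex \<Rightarrow> complex"
  where "twining_character V W \<Phi> g h \<tau> =
    (\<Sum>\<^sub>\<infinity>\<rho>\<in>UNIV. ctrace (mweight V (W g) \<rho>) (\<Phi> g h) *
       exp (2 * of_real pi * \<i> * \<tau> * (\<rho> - cc V / 24)))"

definition class_reps :: "('v \<Rightarrow> 'v) set \<Rightarrow> ('v \<Rightarrow> 'v) set"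
  where "class_reps H = (\<lambda>g. SOME x. x \<in> (\<lambda>k. conj_by k g) ` H) ` H"

definition orbifold_character ::
    "'v::complex_vector voa \<Rightarrow> (('v \<Rightarrow> 'v) \<Rightarrow> ('v, 'w::complex_vector) vmodule) \<Rightarrow>
     (('v \<Rightarrow> 'v) \<Rightarrow> ('v \<Rightarrow> 'v) \<Rightarrow> 'w \<Rightarrow> 'w) \<Rightarrow> ('v \<Rightarrow> 'v) set \<Rightarrow> complex \<Rightarrow> complex"
  where "orbifold_character V W \<Phi> H \<tau> =
    (\<Sum>g\<in>class_reps H. 1 / of_nat (card (centralizer H g)) *
       (\<Sum>h\<in>centralizer H g. twining_character V W \<Phi> g h \<tau>))"

text \<open>The external direct sum \<open>\<Oplus>\<^sub>g W\<^sub>g\<^sup>C\<close>, \<open>C\<close> the centralizer of \<open>g\<close> in \<open>H\<close>, as a space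
  of families indexed by the representatives.\<close>

definition orbifold_space ::
    "(('v \<Rightarrow> 'v) \<Rightarrow> ('v, 'w::complex_vector) vmodule) \<Rightarrow>
     (('v \<Rightarrow> 'v) \<Rightarrow> ('v \<Rightarrow> 'v) \<Rightarrow> 'w \<Rightarrow> 'w) \<Rightarrow> ('v \<Rightarrow> 'v) set \<Rightarrow> (('v \<Rightarrow> 'v) \<Rightarrow> 'w) set"
  where "orbifold_space W \<Phi> H =
    {x. (\<forall>g\<in>class_reps H. x g \<in> mspace (W g) \<and> (\<forall>h\<in>centralizer H g. \<Phi> g h (x g) = x g)) \<and>
        (\<forall>g. g \<notin> class_reps H \<longrightarrow> x g = 0)}"

definition orbifold_weight ::
    "'v voa \<Rightarrow> (('v \<Rightarrow> 'v) \<Rightarrow> ('v, 'w::complex_vector) vmodule) \<Rightarrow>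
     (('v \<Rightarrow> 'v) \<Rightarrow> ('v \<Rightarrow> 'v) \<Rightarrow> 'w \<Rightarrow> 'w) \<Rightarrow> ('v \<Rightarrow> 'v) set \<Rightarrow> complex \<Rightarrow> (('v \<Rightarrow> 'v) \<Rightarrow> 'w) set"
  where "orbifold_weight V W \<Phi> H \<rho> =
    {x \<in> orbifold_space W \<Phi> H. \<forall>g\<in>class_reps H. mact (W g) (conf V) 1 (x g) = \<rho> *\<^sub>C x g}"


section \<open>The semidirect product\<close>

text \<open>\<open>(i, j)\<close> stands for \<open>a\<^sup>i A\<^sup>j\<close>.\<close>

definition semidirect :: "nat \<Rightarrow> nat \<Rightarrow> int \<Rightarrow> (int \<times> nat) monoid"
  where "semidirect q p \<phi> =
    \<lparr>carrier = {0..<int q} \<times> {0..<p},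
     mult = (\<lambda>(i, j) (k, l). ((i + \<phi> ^ j * k) mod int q, (j + l) mod p)),
     one = (0, 0)\<rparr>"

end

theory Submission
  imports Defs "HOL-Algebra.Multiplicative_Group" "HOL-Number_Theory.Pocklington"
begin

text \<open>By the orbit-stabilizer theorem, the character of \<open>V\<^sup>o\<^sup>r\<^sup>b\<^sup>(\<^sup>H\<^sup>)\<close> is the sum of \<open>T(g,h)\<close> over all
  commuting pairs of \<open>H\<close>, divided by the order of \<open>H\<close>. In \<open>G\<close>, an element outside the abelian normal
  subgroup \<open>N = \<langle>aB\<rangle> = \<langle>a, B\<rangle>\<close> has as centralizer exactly one of the \<open>q\<close> conjugates of \<open>\<langle>A\<rangle>\<close>, and each
  conjugate meets \<open>N\<close> in the centre \<open>\<langle>B\<rangle>\<close>. So the commuting pairs of \<open>G\<close> are those of \<open>N\<close> together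
  with \<open>q\<close> conjugate copies of the pairs in \<open>\<langle>A\<rangle>\<close> that are not both in \<open>\<langle>B\<rangle>\<close>; as \<open>T\<close> is conjugation
  invariant, summing gives the formula. The same count applies to each graded dimension, because the
  dimension of an invariant subspace is the average of the traces.\<close>

section \<open>Traces on finite-dimensional subspaces\<close>

text \<open>Provides the facts on linear maps between two different spaces, in particular extension
  from an independent set and images of bases.\<close>

global_interpretation cvec_pair: vector_space_pair
  "scaleC :: complex \<Rightarrow> 'a \<Rightarrow> 'a::complex_vector"
  "scaleC :: complex \<Rightarrow> 'b \<Rightarrow> 'b::complex_vector"
  by unfold_locales

section \<open>Maps linear on a subspace, and coordinates with respect to a basis\<close>

lemma clinear_on_add: "clinear_on S f \<Longrightarrow> x \<in> S \<Longrightarrow> y \<in> S \<Longrightarrow> f (x + y) = f x + f y"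
  by (simp add: clinear_on_def)

lemma clinear_on_scale: "clinear_on S f \<Longrightarrow> x \<in> S \<Longrightarrow> f (c *\<^sub>C x) = c *\<^sub>C f x"
  by (simp add: clinear_on_def)

lemma clinear_on_zero:
  assumes "clinear_on S f" "x \<in> S"
  shows "f 0 = 0"
  using clinear_on_scale[OF assms, of 0] by simp

lemma clinear_on_subset: "clinear_on T f \<Longrightarrow> S \<subseteq> T \<Longrightarrow> clinear_on S f"
  unfolding clinear_on_def by (meson subsetD)

lemma clinear_on_sum:
  assumes "clinear_on S f" "cvec.subspace S" "\<And>i. i \<in> A \<Longrightarrow> x i \<in> S"
  shows "f (\<Sum>i\<in>A. x i) = (\<Sum>i\<in>A. f (x i))"
  using assms(3)
proof (induction A rule: infinite_finite_induct)
  case (insert i A)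
  then have "(\<Sum>i\<in>A. x i) \<in> S"
    by (intro cvec.subspace_sum[OF assms(2)]) auto
  with insert show ?case by (simp add: clinear_on_add[OF assms(1)])
qed (use clinear_on_zero[OF assms(1)] cvec.subspace_0[OF assms(2)] in auto)

text \<open>\<open>finite_dim\<close> only provides a finite set, possibly outside \<open>S\<close>,
  whose span contains \<open>S\<close>. A maximal independent subset of \<open>S\<close> spans the
  subspace, and the exchange lemma makes it finite.\<close>

lemma finite_dim_basis:
  assumes "cvec.subspace S" "finite_dim S"
  obtains E where "E \<subseteq> S" "cvec.independent E" "cvec.span E = S" "finite E"
proof -
  obtain E where E: "E \<subseteq> S" "cvec.independent E" "S \<subseteq> cvec.span E"
    using cvec.maximal_independent_subset by blast
  obtain T where "finite T" "S \<subseteq> cvec.span T" using assms(2) by (auto simp: finite_dim_def)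
  then have "finite E" using cvec.independent_span_bound E by blast
  with E assms(1) that show ?thesis by (meson antisym cvec.span_minimal)
qed

lemma finite_dim_subset: "finite_dim T \<Longrightarrow> S \<subseteq> T \<Longrightarrow> finite_dim S"
  unfolding finite_dim_def by blast

lemma independent_finite_dim:
  assumes "cvec.independent E" "E \<subseteq> S" "finite_dim S"
  shows "finite E"
  using assms cvec.independent_span_bound unfolding finite_dim_def by (meson subset_trans)

lemma sum_representation_expand:
  assumes "finite E" "cvec.independent E" "x \<in> cvec.span E"
  shows "(\<Sum>e\<in>E. cvec.representation E x e *\<^sub>C e) = x"
  using cvec.sum_representation_eq[OF assms(2,3) assms(1)] by auto

lemma representation_lincomb:
  assumes "cvec.independent E" "\<And>i. i \<in> A \<Longrightarrow> x i \<in> cvec.span E"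
  shows "cvec.representation E (\<Sum>i\<in>A. c i *\<^sub>C x i) e
    = (\<Sum>i\<in>A. c i * cvec.representation E (x i) e)"
proof -
  have "cvec.representation E (\<Sum>i\<in>A. c i *\<^sub>C x i) e
      = (\<Sum>i\<in>A. cvec.representation E (c i *\<^sub>C x i) e)"
    using assms by (subst cvec.representation_sum) (auto intro: cvec.span_scale)
  then show ?thesis
    using assms by (simp add: cvec.representation_scale)
qed

text \<open>Both sums equal one double sum, the trace of a product of two matrices taken in either
  order: the transition matrix between the bases and the matrix of \<open>f\<close> from
  \<open>E\<close> to \<open>E'\<close>.\<close>

lemma trace_basis_independent:
  assumes S: "cvec.subspace S" "finite_dim S" and f: "clinear_on S f" "f ` S \<subseteq> S"
    and E: "E \<subseteq> S" "cvec.independent E" "cvec.span E = S"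
    and E': "E' \<subseteq> S" "cvec.independent E'" "cvec.span E' = S"
  shows "(\<Sum>e\<in>E. cvec.representation E (f e) e) = (\<Sum>e\<in>E'. cvec.representation E' (f e) e)"
proof -
  have fin: "finite E" "finite E'" using independent_finite_dim E E' S by blast+
  have fS: "f x \<in> S" if "x \<in> S" for x using f that by auto
  have "(\<Sum>e'\<in>E'. cvec.representation E' (f e') e')
      = (\<Sum>e'\<in>E'. \<Sum>e\<in>E. cvec.representation E e' e * cvec.representation E' (f e) e')"
  proof (rule sum.cong[OF refl])
    fix e' assume e': "e' \<in> E'"
    have "f e' = f (\<Sum>e\<in>E. cvec.representation E e' e *\<^sub>C e)"
      using sum_representation_expand[OF fin(1) E(2), of e'] e' E E' by auto
    also have "\<dots> = (\<Sum>e\<in>E. f (cvec.representation E e' e *\<^sub>C e))"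
      by (rule clinear_on_sum[OF f(1) S(1)]) (use E S in \<open>auto intro: cvec.subspace_scale\<close>)
    also have "\<dots> = (\<Sum>e\<in>E. cvec.representation E e' e *\<^sub>C f e)"
      by (rule sum.cong) (use E clinear_on_scale[OF f(1)] in auto)
    finally have "f e' = (\<Sum>e\<in>E. cvec.representation E e' e *\<^sub>C f e)" .
    then show "cvec.representation E' (f e') e'
        = (\<Sum>e\<in>E. cvec.representation E e' e * cvec.representation E' (f e) e')"
      using representation_lincomb[OF E'(2), of E f "cvec.representation E e'" e'] E E' fS by auto
  qed
  also have "\<dots> = (\<Sum>e\<in>E. \<Sum>e'\<in>E'. cvec.representation E e' e * cvec.representation E' (f e) e')"
    by (rule sum.swap)
  also have "\<dots> = (\<Sum>e\<in>E. cvec.representation E (f e) e)"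
  proof (rule sum.cong[OF refl])
    fix e assume e: "e \<in> E"
    have "f e = (\<Sum>e'\<in>E'. cvec.representation E' (f e) e' *\<^sub>C e')"
      using sum_representation_expand[OF fin(2) E'(2), of "f e"] e E E' fS by auto
    then have "cvec.representation E (f e) e
        = cvec.representation E (\<Sum>e'\<in>E'. cvec.representation E' (f e) e' *\<^sub>C e') e"
      by (rule arg_cong)
    also have "\<dots> = (\<Sum>e'\<in>E'. cvec.representation E' (f e) e' * cvec.representation E e' e)"
      by (rule representation_lincomb[OF E(2)]) (use E E' in auto)
    finally show "(\<Sum>e'\<in>E'. cvec.representation E e' e * cvec.representation E' (f e) e')
        = cvec.representation E (f e) e"
      by (simp add: mult.commute)
  qed
  finally show ?thesis by simp
qed

text \<open>\<open>ctrace\<close> refers to a basis picked by choice; here it is replaced by any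
  basis adapted to the problem.\<close>

lemma ctrace_eq:
  assumes "cvec.subspace S" "finite_dim S" "clinear_on S f" "f ` S \<subseteq> S"
    and E: "E \<subseteq> S" "cvec.independent E" "cvec.span E = S"
  shows "ctrace S f = (\<Sum>e\<in>E. cvec.representation E (f e) e)"
proof -
  define E' where "E' = (SOME E. E \<subseteq> S \<and> cvec.independent E \<and> cvec.span E = S)"
  have "E' \<subseteq> S \<and> cvec.independent E' \<and> cvec.span E' = S"
    unfolding E'_def by (rule someI[of _ E]) (use E in auto)
  then have "(\<Sum>e\<in>E'. cvec.representation E' (f e) e) = (\<Sum>e\<in>E. cvec.representation E (f e) e)"
    using trace_basis_independent[OF assms(1-4)] E by blast
  then show ?thesis by (simp add: ctrace_def E'_def Let_def)
qed

text \<open>A map linear only on \<open>S\<close> may be arbitrary elsewhere. Prescribing its values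
  on a basis of \<open>S\<close> gives a globally linear map, to which the facts on images of
  independent sets apply.\<close>

lemma clinear_on_extend:
  assumes S: "cvec.subspace S" and f: "clinear_on S f"
  obtains g where "Vector_Spaces.linear scaleC scaleC g" "\<And>x. x \<in> S \<Longrightarrow> g x = f x"
proof -
  obtain E where E: "E \<subseteq> S" "cvec.independent E" "S \<subseteq> cvec.span E"
    using cvec.maximal_independent_subset by blast
  obtain g where g: "Vector_Spaces.linear scaleC scaleC g" "\<And>x. x \<in> E \<Longrightarrow> g x = f x"
    using cvec_pair.linear_independent_extend[OF E(2), of f] by blast
  have "x \<in> S \<and> g x = f x" if "x \<in> cvec.span E" for x
    using that
  proof (induction rule: cvec.span_induct_alt)
    case base
    show ?case using cvec.subspace_0[OF S] clinear_on_zero[OF f] cvec_pair.linear_0[OF g(1)] by auto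
  next
    case (step c x y)
    then show ?case
      using E g S f by (auto simp: subset_iff cvec_pair.linear_add cvec_pair.linear_scale
          clinear_on_add clinear_on_scale cvec.subspace_add cvec.subspace_scale)
  qed
  with E g that show ?thesis by blast
qed

text \<open>The image of a basis of \<open>S\<close> is a basis of \<open>S'\<close>, and in these
  two bases \<open>f\<close> and \<open>f'\<close> have the same diagonal entries.\<close>

lemma ctrace_conjugate:
  assumes S: "cvec.subspace S" "finite_dim S" and f: "clinear_on S f" "f ` S \<subseteq> S"
    and S': "cvec.subspace S'" "finite_dim S'" and f': "clinear_on S' f'" "f' ` S' \<subseteq> S'"
    and \<psi>: "clinear_on S \<psi>" "bij_betw \<psi> S S'"
    and eq: "\<And>x. x \<in> S \<Longrightarrow> f' (\<psi> x) = \<psi> (f x)"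
  shows "ctrace S' f' = ctrace S f"
proof -
  obtain E where E: "E \<subseteq> S" "cvec.independent E" "cvec.span E = S" "finite E"
    using finite_dim_basis S by blast
  obtain g where g: "Vector_Spaces.linear scaleC scaleC g" "\<And>x. x \<in> S \<Longrightarrow> g x = \<psi> x"
    using clinear_on_extend[OF S(1) \<psi>(1)] by blast
  have gimg: "g ` S = S'" and ginj: "inj_on g S"
    using \<psi>(2) g(2) by (auto simp: bij_betw_def inj_on_def)
  have ind: "cvec.independent (g ` E)"
    using cvec_pair.linear_independent_injective_image[OF g(1) E(2)] ginj E(3) by blast
  have span: "cvec.span (g ` E) = S'"
    using cvec_pair.linear_span_image[OF g(1), of E] E(3) gimg by simp
  have injE: "inj_on g E" using ginj E(1) inj_on_subset by blast
  have fS: "f x \<in> S" if "x \<in> S" for x using f that by auto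
  have "cvec.representation (g ` E) (f' (g e)) (g e) = cvec.representation E (f e) e"
    if e: "e \<in> E" for e
  proof -
    have "f' (g e) = g (f e)" using eq e E(1) g(2) fS by auto
    also have "\<dots> = g (\<Sum>d\<in>E. cvec.representation E (f e) d *\<^sub>C d)"
      using sum_representation_expand[OF E(4,2), of "f e"] e E fS by auto
    also have "\<dots> = (\<Sum>d\<in>E. cvec.representation E (f e) d *\<^sub>C g d)"
      by (simp add: cvec_pair.linear_sum[OF g(1)] cvec_pair.linear_scale[OF g(1)])
    finally have "cvec.representation (g ` E) (f' (g e)) (g e)
        = (\<Sum>d\<in>E. cvec.representation E (f e) d * cvec.representation (g ` E) (g d) (g e))"
      using representation_lincomb[OF ind, of E g] by (auto intro: cvec.span_base)
    also have "\<dots> = (\<Sum>d\<in>E. if d = e then cvec.representation E (f e) d else 0)"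
      by (intro sum.cong refl)
        (use e injE in \<open>auto simp: cvec.representation_basis[OF ind] inj_on_eq_iff\<close>)
    also have "\<dots> = cvec.representation E (f e) e" using E(4) e by simp
    finally show ?thesis .
  qed
  moreover have "ctrace S' f' = (\<Sum>e\<in>g ` E. cvec.representation (g ` E) (f' e) e)"
    by (rule ctrace_eq[OF S' f']) (use gimg E(1) ind span in auto)
  ultimately show ?thesis
    using ctrace_eq[OF S f E(1-3)] by (simp add: sum.reindex[OF injE])
qed

text \<open>A basis of \<open>F\<close> is extended to a basis of \<open>S\<close>. The diagonal
  entries of \<open>f\<close> are then 1 on the basis of \<open>F\<close>, and 0 on the rest because
  \<open>f\<close> takes its values in \<open>F\<close>.\<close>

lemma ctrace_projection:
  assumes S: "cvec.subspace S" "finite_dim S" and f: "clinear_on S f" "f ` S \<subseteq> F"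
    and F: "cvec.subspace F" "F \<subseteq> S" "\<And>x. x \<in> F \<Longrightarrow> f x = x"
  shows "ctrace S f = of_nat (cvec.dim F)"
proof -
  obtain B where B: "B \<subseteq> F" "cvec.independent B" "cvec.span B = F" "finite B"
    using finite_dim_basis[OF F(1) finite_dim_subset[OF S(2) F(2)]] by blast
  obtain E where E: "B \<subseteq> E" "E \<subseteq> S" "cvec.independent E" "S \<subseteq> cvec.span E"
    using cvec.maximal_independent_subset_extend[of B S] B F by blast
  have spanE: "cvec.span E = S" using E S by (meson antisym cvec.span_minimal)
  have fin: "finite E" using independent_finite_dim E S by blast
  have B_part: "cvec.representation E (f e) e = 1" if "e \<in> B" for e
    using that B E F(3) cvec.representation_basis[OF E(3)] by (auto simp: subset_iff)
  have C_part: "cvec.representation E (f e) e = 0" if "e \<in> E - B" for e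
  proof -
    have "f e \<in> cvec.span B" using that f(2) E(2) B(3) by blast
    then have "cvec.representation E (f e) = cvec.representation B (f e)"
      using cvec.representation_extend[OF E(3) _ E(1)] by blast
    then show ?thesis using cvec.representation_ne_zero[of B "f e" e] that by auto
  qed
  have "ctrace S f = (\<Sum>e\<in>E. cvec.representation E (f e) e)"
    using f(2) F(2) by (intro ctrace_eq[OF S f(1) _ E(2,3) spanE]) blast
  also have "\<dots> = (\<Sum>e\<in>B. cvec.representation E (f e) e)"
    by (rule sum.mono_neutral_right[OF fin E(1)]) (use C_part in blast)
  also have "\<dots> = (\<Sum>e\<in>B. 1)"
    by (rule sum.cong[OF refl B_part])
  also have "\<dots> = of_nat (card B)" by simp
  also have "card B = cvec.dim F"
    using cvec.dim_span_eq_card_independent[OF B(2)] B(3) by simp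
  finally show ?thesis .
qed

text \<open>In a fixed basis the trace is linear in the operator. The scalar will be the inverse of
  the size of \<open>C\<close>.\<close>

lemma ctrace_average:
  assumes S: "cvec.subspace S" "finite_dim S" and fin: "finite C"
    and R: "\<And>h. h \<in> C \<Longrightarrow> clinear_on S (R h)" "\<And>h. h \<in> C \<Longrightarrow> R h ` S \<subseteq> S"
  shows "clinear_on S (\<lambda>x. c *\<^sub>C (\<Sum>h\<in>C. R h x))"
    and "ctrace S (\<lambda>x. c *\<^sub>C (\<Sum>h\<in>C. R h x)) = c * (\<Sum>h\<in>C. ctrace S (R h))"
proof -
  obtain E where E: "E \<subseteq> S" "cvec.independent E" "cvec.span E = S" "finite E"
    using finite_dim_basis S by blast
  show lin: "clinear_on S (\<lambda>x. c *\<^sub>C (\<Sum>h\<in>C. R h x))"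
    using R(1) by (simp add: clinear_on_def sum.distrib cvec.scale_right_distrib
        cvec.scale_sum_right mult.commute)
  have RS: "R h x \<in> S" if "h \<in> C" "x \<in> S" for h x using R(2) that by blast
  have "ctrace S (\<lambda>x. c *\<^sub>C (\<Sum>h\<in>C. R h x))
      = (\<Sum>e\<in>E. cvec.representation E (c *\<^sub>C (\<Sum>h\<in>C. R h e)) e)"
    by (rule ctrace_eq[OF S lin _ E(1-3)])
      (use RS S(1) in \<open>auto intro!: cvec.subspace_scale cvec.subspace_sum\<close>)
  also have "\<dots> = (\<Sum>e\<in>E. \<Sum>h\<in>C. c * cvec.representation E (R h e) e)"
  proof (rule sum.cong[OF refl])
    fix e assume "e \<in> E"
    then show "cvec.representation E (c *\<^sub>C (\<Sum>h\<in>C. R h e)) e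
        = (\<Sum>h\<in>C. c * cvec.representation E (R h e) e)"
      using representation_lincomb[OF E(2), of C "\<lambda>h. R h e" "\<lambda>_. c" e] RS E(1,3)
      by (auto simp: cvec.scale_sum_right)
  qed
  also have "\<dots> = (\<Sum>h\<in>C. c * (\<Sum>e\<in>E. cvec.representation E (R h e) e))"
    by (subst sum.swap) (simp add: sum_distrib_left)
  also have "\<dots> = c * (\<Sum>h\<in>C. ctrace S (R h))"
    using ctrace_eq[OF S R(1) R(2) E(1-3)] by (simp add: sum_distrib_left)
  finally show "ctrace S (\<lambda>x. c *\<^sub>C (\<Sum>h\<in>C. R h x)) = c * (\<Sum>h\<in>C. ctrace S (R h))" .
qed

text \<open>The average of the operators \<open>R h\<close> is a projection onto the common fixed
  vectors, so its trace is their dimension. The map \<open>m l\<close> plays the role of left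
  translation by \<open>l\<close>: it permutes the terms of the average, which is therefore fixed by
  every \<open>R l\<close>.\<close>

lemma dim_invariants:
  assumes S: "cvec.subspace S" "finite_dim S" and C: "finite C" "C \<noteq> {}"
    and R: "\<And>h. h \<in> C \<Longrightarrow> clinear_on S (R h)" "\<And>h. h \<in> C \<Longrightarrow> R h ` S \<subseteq> S"
    and m: "\<And>l. l \<in> C \<Longrightarrow> bij_betw (m l) C C"
      "\<And>l h x. l \<in> C \<Longrightarrow> h \<in> C \<Longrightarrow> x \<in> S \<Longrightarrow> R l (R h x) = R (m l h) x"
  shows "cvec.subspace {x\<in>S. \<forall>h\<in>C. R h x = x}"
    and "of_nat (cvec.dim {x\<in>S. \<forall>h\<in>C. R h x = x})
      = 1 / of_nat (card C) * (\<Sum>h\<in>C. ctrace S (R h))"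
proof -
  define F where "F = {x\<in>S. \<forall>h\<in>C. R h x = x}"
  define f where "f = (\<lambda>x. (1 / of_nat (card C)) *\<^sub>C (\<Sum>h\<in>C. R h x))"
  have RS: "R h x \<in> S" if "h \<in> C" "x \<in> S" for h x using R(2) that by blast
  show sub: "cvec.subspace {x\<in>S. \<forall>h\<in>C. R h x = x}"
    using S(1) clinear_on_add[OF R(1)] clinear_on_scale[OF R(1)] clinear_on_zero[OF R(1)]
    by (auto simp: cvec.subspace_def)
  have c0: "(of_nat (card C) :: complex) \<noteq> 0" using C by simp
  have fF: "f x \<in> F" if x: "x \<in> S" for x
  proof -
    have sS: "(\<Sum>h\<in>C. R h x) \<in> S"
      using RS x S(1) by (auto intro!: cvec.subspace_sum)
    have "R l (f x) = f x" if l: "l \<in> C" for l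
    proof -
      have "R l (f x) = (1 / of_nat (card C)) *\<^sub>C (\<Sum>h\<in>C. R l (R h x))"
        using clinear_on_scale[OF R(1)[OF l] sS]
          clinear_on_sum[OF R(1)[OF l] S(1), of C "\<lambda>h. R h x"] RS x
        by (simp add: f_def)
      also have "(\<Sum>h\<in>C. R l (R h x)) = (\<Sum>h\<in>C. R (m l h) x)"
        using m(2) l x by simp
      also have "\<dots> = (\<Sum>h\<in>C. R h x)"
        by (rule sum.reindex_bij_betw[OF m(1)[OF l]])
      finally show ?thesis by (simp add: f_def)
    qed
    then show ?thesis
      using sS S(1) by (auto simp: F_def f_def intro: cvec.subspace_scale)
  qed
  have "ctrace S f = of_nat (cvec.dim F)"
  proof (rule ctrace_projection[OF S])
    show "clinear_on S f" unfolding f_def by (rule ctrace_average[OF S C(1) R])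
    show "f x = x" if "x \<in> F" for x
    proof -
      have "(\<Sum>h\<in>C. R h x) = (\<Sum>h\<in>C. x)" using that by (auto simp: F_def)
      also have "\<dots> = of_nat (card C) *\<^sub>C x"
        by (induction C rule: infinite_finite_induct)
          (auto simp: cvec.scale_left_distrib)
      finally show ?thesis using c0 by (simp add: f_def)
    qed
  qed (use fF sub in \<open>auto simp: F_def\<close>)
  moreover have "ctrace S f = 1 / of_nat (card C) * (\<Sum>h\<in>C. ctrace S (R h))"
    unfolding f_def by (rule ctrace_average[OF S C(1) R])
  ultimately show "of_nat (cvec.dim {x\<in>S. \<forall>h\<in>C. R h x = x})
      = 1 / of_nat (card C) * (\<Sum>h\<in>C. ctrace S (R h))"
    by (simp add: F_def)
qed

text \<open>The families with a single nonzero entry, taken from a basis of some \<open>F g\<close>,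
  form a basis of the whole space.\<close>

lemma dim_families:
  fixes F :: "'i \<Rightarrow> 'a::complex_vector set"
  assumes R: "finite R" and F: "\<And>g. g \<in> R \<Longrightarrow> cvec.subspace (F g)" "\<And>g. g \<in> R \<Longrightarrow> finite_dim (F g)"
  shows "cvec.dim {x. (\<forall>g\<in>R. x g \<in> F g) \<and> (\<forall>g. g \<notin> R \<longrightarrow> x g = 0)} = (\<Sum>g\<in>R. cvec.dim (F g))"
    (is "cvec.dim ?X = _")
proof -
  have "\<forall>g\<in>R. \<exists>B. B \<subseteq> F g \<and> cvec.independent B \<and> cvec.span B = F g \<and> finite B"
    using finite_dim_basis F by metis
  then obtain B where B: "\<And>g. g \<in> R \<Longrightarrow> B g \<subseteq> F g" "\<And>g. g \<in> R \<Longrightarrow> cvec.independent (B g)"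
    "\<And>g. g \<in> R \<Longrightarrow> cvec.span (B g) = F g" "\<And>g. g \<in> R \<Longrightarrow> finite (B g)"
    by metis
  \<comment> \<open>The family with entry \<open>b\<close> at index \<open>g\<close> and 0
    elsewhere.\<close>
  define s :: "'i \<times> 'a \<Rightarrow> 'i \<Rightarrow> 'a" where "s = (\<lambda>(g, b) x. if x = g then b else 0)"
  define P where "P = (SIGMA g:R. B g)"
  have finP: "finite P" using R B by (auto simp: P_def)
  \<comment> \<open>A zero entry would give the same family at every index. A nonzero entry reveals
    its index, which makes \<open>s\<close> injective.\<close>
  have nz: "b \<noteq> 0" if "(g, b) \<in> P" for g b
    using that B(2) cvec.dependent_zero unfolding P_def by blast
  have inj: "inj_on s P"
  proof (rule inj_onI)
    fix x y assume xy: "x \<in> P" "y \<in> P" "s x = s y"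
    obtain g b where x: "x = (g, b)" by (cases x)
    obtain k d where y: "y = (k, d)" by (cases y)
    have "s x g = s y g" using xy by simp
    then show "x = y" using x y nz[of g b] xy(1) by (auto simp: s_def split: if_splits)
  qed
  \<comment> \<open>The entry at \<open>k\<close> of a combination involves only the basis of
    \<open>F k\<close>; spanning and independence both reduce to that basis.\<close>
  have sumP: "(\<Sum>p\<in>P. c p *\<^sub>C s p) k = (\<Sum>b\<in>B k. c (k, b) *\<^sub>C b)" if "k \<in> R" for c k
  proof -
    have "(\<Sum>p\<in>P. c p *\<^sub>C s p) k = (\<Sum>p\<in>P. c p *\<^sub>C s p k)"
      using finP by induction (auto simp: scaleC_fun_def)
    also have "\<dots> = (\<Sum>g\<in>R. \<Sum>b\<in>B g. c (g, b) *\<^sub>C s (g, b) k)"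
      unfolding P_def using R B(4) by (subst sum.Sigma) (auto simp: case_prod_unfold)
    also have "\<dots> = (\<Sum>g\<in>R. if g = k then (\<Sum>b\<in>B g. c (g, b) *\<^sub>C b) else 0)"
      by (intro sum.cong refl) (auto simp: s_def)
    finally show ?thesis using R that by simp
  qed
  have "cvec.dim ?X = card (s ` P)"
  proof (rule cvec.dim_unique[OF _ _ _ refl])
    show "s ` P \<subseteq> ?X"
    proof clarsimp
      fix g b assume gb: "(g, b) \<in> P"
      then have "g \<in> R" "b \<in> F g" using B(1) by (auto simp: P_def)
      then show "(\<forall>k\<in>R. s (g, b) k \<in> F k) \<and> (\<forall>k. k \<notin> R \<longrightarrow> s (g, b) k = 0)"
        using cvec.subspace_0[OF F(1)] by (auto simp: s_def)
    qed
    show "?X \<subseteq> cvec.span (s ` P)"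
    proof
      fix x assume x: "x \<in> ?X"
      have "x = (\<Sum>p\<in>P. cvec.representation (B (fst p)) (x (fst p)) (snd p) *\<^sub>C s p)" (is "_ = ?y")
      proof
        fix k show "x k = ?y k"
        proof (cases "k \<in> R")
          case True
          then show ?thesis
            using sum_representation_expand[OF B(4,2), of k "x k"] x B(3) by (simp add: sumP)
        next
          case False
          have "?y k = (\<Sum>p\<in>P. cvec.representation (B (fst p)) (x (fst p)) (snd p) *\<^sub>C s p k)"
            using finP by induction (auto simp: scaleC_fun_def)
          also have "\<dots> = 0"
            by (rule sum.neutral) (use False in \<open>auto simp: P_def s_def\<close>)
          finally show ?thesis using x False by simp
        qed
      qed
      also have "\<dots> \<in> cvec.span (s ` P)"
        by (intro cvec.span_sum cvec.span_scale cvec.span_base) auto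
      finally show "x \<in> cvec.span (s ` P)" .
    qed
    show "cvec.independent (s ` P)"
    proof (rule cvec.independent_if_scalars_zero)
      show "finite (s ` P)" using finP by simp
    next
      fix u v assume u: "(\<Sum>v\<in>s ` P. u v *\<^sub>C v) = 0" and "v \<in> s ` P"
      then obtain k b where v: "v = s (k, b)" "(k, b) \<in> P" by auto
      then have k: "k \<in> R" "b \<in> B k" by (auto simp: P_def)
      have "(\<Sum>p\<in>P. u (s p) *\<^sub>C s p) = 0" using u inj by (simp add: sum.reindex)
      then have "(\<Sum>b\<in>B k. u (s (k, b)) *\<^sub>C b) = 0"
        using sumP[OF k(1), of "\<lambda>p. u (s p)"] by simp
      then show "u v = 0"
        using cvec.independentD[OF B(2)[OF k(1)] B(4)[OF k(1)] subset_refl, of "\<lambda>b. u (s (k, b))" b] k v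
        by simp
    qed
  qed
  also have "\<dots> = (\<Sum>g\<in>R. card (B g))"
    using inj R B(4) by (simp add: card_image P_def)
  also have "\<dots> = (\<Sum>g\<in>R. cvec.dim (F g))"
    by (intro sum.cong refl, rule cvec.dim_unique[OF B(1) _ B(2) refl, symmetric]) (use B(3) in auto)
  finally show ?thesis .
qed

section \<open>Sums over conjugacy classes\<close>

text \<open>Trades the inverse for an equation between compositions, the form in which relations of
  the group and membership in a centralizer can be checked.\<close>

lemma conj_by_eq_iff: "bij k \<Longrightarrow> conj_by k g = h \<longleftrightarrow> k \<circ> g = h \<circ> k"
proof -
  assume k: "bij k"
  have "conj_by k g = h \<longleftrightarrow> (\<forall>x. k (g (inv_into UNIV k x)) = h x)"
    by (simp add: conj_by_def fun_eq_iff)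
  also have "\<dots> \<longleftrightarrow> (\<forall>x. k (g x) = h (k x))"
    using k by (metis bij_inv_eq_iff)
  finally show ?thesis by (simp add: fun_eq_iff)
qed

text \<open>States the group laws directly for functions under composition, to match
  \<open>conj_by\<close> and \<open>centralizer\<close>. It serves for \<open>G\<close> and for its
  subgroups alike.\<close>

locale finite_bijection_group =
  fixes H :: "('v \<Rightarrow> 'v) set"
  assumes fin: "finite H"
    and bij: "g \<in> H \<Longrightarrow> bij g"
    and id: "id \<in> H"
    and comp: "g \<in> H \<Longrightarrow> h \<in> H \<Longrightarrow> g \<circ> h \<in> H"
    and inv: "g \<in> H \<Longrightarrow> inv_into UNIV g \<in> H"
begin

section \<open>Conjugation as a group action\<close>

lemma conj_in: "k \<in> H \<Longrightarrow> g \<in> H \<Longrightarrow> conj_by k g \<in> H"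
  by (simp add: conj_by_def comp inv)

lemma conj_comp:
  assumes "k \<in> H" "l \<in> H"
  shows "conj_by k (conj_by l g) = conj_by (k \<circ> l) g"
  using bij[OF assms(1)] bij[OF assms(2)] by (simp add: conj_by_def o_inv_distrib comp_assoc)

lemma conj_id [simp]: "conj_by id g = g"
  by (simp add: conj_by_def)

lemma inv_comp: "k \<in> H \<Longrightarrow> inv_into UNIV k \<circ> k = id" "k \<in> H \<Longrightarrow> k \<circ> inv_into UNIV k = id"
  using bij_is_inj[OF bij] bij_is_surj[OF bij] by (simp_all flip: surj_iff)

lemma conj_inv: "k \<in> H \<Longrightarrow> conj_by (inv_into UNIV k) (conj_by k g) = g"
  by (simp add: conj_comp inv inv_comp)

lemma conj_inv': "k \<in> H \<Longrightarrow> conj_by k (conj_by (inv_into UNIV k) g) = g"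
  by (simp add: conj_comp inv inv_comp)

lemma conj_mult:
  assumes "k \<in> H"
  shows "conj_by k g \<circ> conj_by k h = conj_by k (g \<circ> h)"
proof -
  have "conj_by k g \<circ> conj_by k h = k \<circ> g \<circ> (inv_into UNIV k \<circ> k) \<circ> h \<circ> inv_into UNIV k"
    by (simp add: conj_by_def comp_assoc)
  then show ?thesis using assms by (simp add: inv_comp conj_by_def comp_assoc)
qed

lemma conj_centralizer: "g \<in> H \<Longrightarrow> h \<in> centralizer H g \<Longrightarrow> conj_by h g = g"
  using bij by (auto simp: centralizer_def conj_by_eq_iff)

text \<open>Conjugation by \<open>k\<close> respects composition, hence carries centralizers into
  centralizers; conjugation by the inverse of \<open>k\<close> undoes it.\<close>

lemma bij_betw_conj_centralizer:
  assumes k: "k \<in> H" and g: "g \<in> H"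
  shows "bij_betw (conj_by k) (centralizer H g) (centralizer H (conj_by k g))"
proof -
  have 1: "conj_by l h \<in> centralizer H (conj_by l g)"
    if "l \<in> H" "h \<in> centralizer H g" for l g h
    using that by (auto simp: centralizer_def conj_in conj_mult)
  show ?thesis
    by (rule bij_betw_byWitness[where f' = "conj_by (inv_into UNIV k)"])
      (use 1 k inv[OF k] conj_inv in \<open>auto simp: conj_inv' intro: 1[of "inv_into UNIV k" _ "conj_by k g", simplified conj_inv[OF k]]\<close>)
qed

text \<open>The fibres of the map from \<open>k\<close> to \<open>conj_by k g\<close> are left
  cosets of the centralizer, one for each element of the class.\<close>

lemma card_class_times_centralizer:
  assumes g: "g \<in> H"
  shows "card ((\<lambda>k. conj_by k g) ` H) * card (centralizer H g) = card H"
proof -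
  have "card {k\<in>H. conj_by k g = y} = card (centralizer H g)" if y: "y \<in> (\<lambda>k. conj_by k g) ` H" for y
  proof -
    obtain k where k: "k \<in> H" "y = conj_by k g" using y by auto
    have "bij_betw (\<lambda>h. k \<circ> h) (centralizer H g) {l\<in>H. conj_by l g = y}"
    proof (rule bij_betw_byWitness[where f' = "\<lambda>l. inv_into UNIV k \<circ> l"])
      show "(\<circ>) k ` centralizer H g \<subseteq> {l \<in> H. conj_by l g = y}"
        using k g conj_centralizer by (auto simp: comp conj_comp[symmetric] centralizer_def)
      show "(\<circ>) (inv_into UNIV k) ` {l \<in> H. conj_by l g = y} \<subseteq> centralizer H g"
      proof (rule image_subsetI)
        fix l assume "l \<in> {l \<in> H. conj_by l g = y}"
        then have l: "l \<in> H" "conj_by l g = y" by auto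
        then have "conj_by (inv_into UNIV k \<circ> l) g = g"
          using k by (simp add: conj_comp[symmetric] inv conj_inv)
        then show "inv_into UNIV k \<circ> l \<in> centralizer H g"
          using l k bij[of "inv_into UNIV k \<circ> l"]
          by (simp add: centralizer_def comp inv conj_by_eq_iff)
      qed
    qed (use k in \<open>auto simp: comp_assoc[symmetric] inv_comp\<close>)
    then show ?thesis by (simp add: bij_betw_same_card)
  qed
  moreover have "card H = (\<Sum>y\<in>(\<lambda>k. conj_by k g) ` H. card {k\<in>H. conj_by k g = y})"
    using sum.image_gen[OF fin, of "\<lambda>_. 1::nat" "\<lambda>k. conj_by k g"] by simp
  ultimately show ?thesis by simp
qed

lemma class_reps_subset: "class_reps H \<subseteq> H"
  unfolding class_reps_def
proof (rule image_subsetI)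
  fix g assume g: "g \<in> H"
  let ?O = "(\<lambda>k. conj_by k g) ` H"
  have "conj_by g g \<in> ?O" using g by (rule imageI)
  then have "(SOME x. x \<in> ?O) \<in> ?O" by (rule someI[of "\<lambda>x. x \<in> ?O"])
  moreover have "?O \<subseteq> H" using g conj_in by (simp add: image_subset_iff)
  ultimately show "(SOME x. x \<in> ?O) \<in> H" by (rule rev_subsetD)
qed

text \<open>By the orbit-stabilizer theorem, a class weighs as much as its representative divided by the
  order of the centralizer.\<close>

lemma sum_class_reps:
  fixes c :: "('v \<Rightarrow> 'v) \<Rightarrow> complex"
  assumes c: "\<And>k g. k \<in> H \<Longrightarrow> g \<in> H \<Longrightarrow> c (conj_by k g) = c g"
  shows "(\<Sum>g\<in>class_reps H. 1 / of_nat (card (centralizer H g)) * c g)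
    = 1 / of_nat (card H) * (\<Sum>g\<in>H. c g)"
proof -
  define orb where "orb g = (\<lambda>k. conj_by k g) ` H" for g
  \<comment> \<open>The choice depends on \<open>g\<close> only through the set
    \<open>orb g\<close>, so \<open>s\<close> is constant on each class and its fibres are exactly
    the classes.\<close>
  define s where "s g = (SOME x. x \<in> orb g)" for g
  have reps: "class_reps H = s ` H" by (simp add: class_reps_def s_def orb_def)
  have orb_self: "g \<in> orb g" for g
    unfolding orb_def using id by (metis conj_id imageI)
  have orb_H: "orb g \<subseteq> H" if "g \<in> H" for g
    using that by (auto simp: orb_def conj_in)
  have orb_sub: "orb x \<subseteq> orb g" if "x \<in> orb g" for x g
    using that by (auto simp: orb_def conj_comp comp)
  have orb_sym: "g \<in> orb x" if x: "x \<in> orb g" for x g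
  proof -
    obtain k where "k \<in> H" "x = conj_by k g" using x by (auto simp: orb_def)
    then have "g = conj_by (inv_into UNIV k) x" "inv_into UNIV k \<in> H" by (simp_all add: conj_inv inv)
    then show ?thesis by (auto simp: orb_def)
  qed
  have orb_eq: "orb x = orb g" if "x \<in> orb g" for x g
    using orb_sub orb_sym that by (meson subset_antisym)
  have s_orb: "s g \<in> orb g" for g
    unfolding s_def using someI[of "\<lambda>x. x \<in> orb g", OF orb_self] .
  have s_H: "s g \<in> H" if "g \<in> H" for g using s_orb orb_H that by blast
  have fibre: "{g\<in>H. s g = x} = orb x" if x: "x \<in> s ` H" for x
  proof -
    obtain g0 where g0: "g0 \<in> H" "x = s g0" using x by auto
    have "s g = x" if "g \<in> orb x" for g
      using orb_eq[OF that] orb_eq[OF s_orb[of g0]] g0 by (simp add: s_def)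
    moreover have "g \<in> orb x" if "s g = x" for g
      using orb_sym[OF s_orb[of g]] that by simp
    moreover have "orb x \<subseteq> H" using orb_H s_H g0 by blast
    ultimately show ?thesis by blast
  qed
  have "(\<Sum>g\<in>H. c g) = (\<Sum>x\<in>s ` H. \<Sum>g\<in>{g\<in>H. s g = x}. c g)"
    by (rule sum.image_gen[OF fin])
  also have "\<dots> = (\<Sum>x\<in>s ` H. of_nat (card (orb x)) * c x)"
  proof (rule sum.cong[OF refl])
    fix x assume x: "x \<in> s ` H"
    then have xH: "x \<in> H" using s_H by auto
    have "(\<Sum>g\<in>orb x. c g) = (\<Sum>g\<in>orb x. c x)"
      using c xH by (intro sum.cong) (auto simp: orb_def)
    then show "(\<Sum>g\<in>{g\<in>H. s g = x}. c g) = of_nat (card (orb x)) * c x"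
      by (simp add: fibre[OF x])
  qed
  finally have sumH: "(\<Sum>g\<in>H. c g) = (\<Sum>x\<in>s ` H. of_nat (card (orb x)) * c x)" .
  have H0: "card H \<noteq> 0" using fin id by auto
  have coeff: "1 / of_nat (card (centralizer H x)) = (of_nat (card (orb x)) / of_nat (card H) :: complex)"
    if "x \<in> s ` H" for x
  proof -
    have eq: "card (orb x) * card (centralizer H x) = card H"
      using card_class_times_centralizer[of x] s_H that by (auto simp: orb_def)
    with H0 have "card (centralizer H x) \<noteq> 0" "card (orb x) \<noteq> 0" by (metis mult_eq_0_iff)+
    then show ?thesis by (simp add: eq[symmetric])
  qed
  show ?thesis
    unfolding reps sumH sum_distrib_left
    by (rule sum.cong[OF refl]) (simp add: coeff)
qed

text \<open>The inner sum is constant on classes, by reindexing with conjugation. Applied to twining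
  characters, this turns an orbifold character into a sum over commuting pairs divided by the group
  order.\<close>

lemma centralizer_average:
  fixes T :: "('v \<Rightarrow> 'v) \<Rightarrow> ('v \<Rightarrow> 'v) \<Rightarrow> complex"
  assumes T: "\<And>k g h. k \<in> H \<Longrightarrow> g \<in> H \<Longrightarrow> h \<in> centralizer H g \<Longrightarrow>
      T (conj_by k g) (conj_by k h) = T g h"
  shows "(\<Sum>g\<in>class_reps H. 1 / of_nat (card (centralizer H g)) * (\<Sum>h\<in>centralizer H g. T g h))
    = 1 / of_nat (card H) * (\<Sum>g\<in>H. \<Sum>h\<in>centralizer H g. T g h)"
proof (rule sum_class_reps)
  fix k g assume k: "k \<in> H" and g: "g \<in> H"
  have "(\<Sum>h\<in>centralizer H (conj_by k g). T (conj_by k g) h)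
      = (\<Sum>h\<in>centralizer H g. T (conj_by k g) (conj_by k h))"
    by (rule sum.reindex_bij_betw[OF bij_betw_conj_centralizer[OF k g], symmetric])
  then show "(\<Sum>h\<in>centralizer H (conj_by k g). T (conj_by k g) h) = (\<Sum>h\<in>centralizer H g. T g h)"
    using T k g by simp
qed

end

section \<open>Commuting pairs in the semidirect product\<close>

text \<open>The least divisor of \<open>p\<close> with this property is the multiplicative order,
  since the order itself divides \<open>p\<close>. The order is taken of the residue of \<phi> as a
  natural number.\<close>

lemma multiplicative_order:
  fixes \<phi> :: int
  assumes p: "0 < p" and phi: "[\<phi> ^ p = 1] (mod int q)" and q: "0 < q"
    and r: "r = (LEAST d. d dvd p \<and> [\<phi> ^ d = 1] (mod int q))"
  shows "[\<phi> ^ d = 1] (mod int q) \<longleftrightarrow> r dvd d" and "r dvd p" and "0 < r"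
proof -
  define n where "n = nat (\<phi> mod int q)"
  have "[int n = \<phi>] (mod int q)" using q by (simp add: n_def cong_def)
  then have "[\<phi> ^ d = 1] (mod int q) \<longleftrightarrow> [int (n ^ d) = int 1] (mod int q)" for d
    by (simp add: cong_pow cong_def) (metis cong_def cong_pow)
  then have iff: "[\<phi> ^ d = 1] (mod int q) \<longleftrightarrow> ord q n dvd d" for d
    using cong_int_iff[of "n ^ d" 1 q] by (simp add: ord_divides')
  have "r = ord q n"
    unfolding r
    by (rule Least_equality) (use phi p iff in \<open>auto intro: dvd_imp_le dvd_pos_nat\<close>)
  with iff phi p show "[\<phi> ^ d = 1] (mod int q) \<longleftrightarrow> r dvd d" "r dvd p" "0 < r"
    by (auto intro: dvd_pos_nat)
qed

lemma semidirect_simps: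
  "carrier (semidirect q p \<phi>) = {0..<int q} \<times> {0..<p}"
  "(i, j) \<otimes>\<^bsub>semidirect q p \<phi>\<^esub> (k, l) = ((i + \<phi> ^ j * k) mod int q, (j + l) mod p)"
  "\<one>\<^bsub>semidirect q p \<phi>\<^esub> = (0, 0)"
  by (simp_all add: semidirect_def)

text \<open>The second components of the two products always agree, so only the first ones,
  \<open>i + \<phi> ^ j * k\<close> and \<open>k + \<phi> ^ l * i\<close>, have to be
  compared.\<close>

lemma semidirect_commute_iff:
  "(i, j) \<otimes>\<^bsub>semidirect q p \<phi>\<^esub> (k, l) = (k, l) \<otimes>\<^bsub>semidirect q p \<phi>\<^esub> (i, j)
    \<longleftrightarrow> [i * (1 - \<phi> ^ l) = k * (1 - \<phi> ^ j)] (mod int q)"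
proof -
  have "[i + \<phi> ^ j * k = k + \<phi> ^ l * i] (mod int q)
      \<longleftrightarrow> [i * (1 - \<phi> ^ l) = k * (1 - \<phi> ^ j)] (mod int q)"
    by (simp add: cong_iff_dvd_diff algebra_simps)
  then show ?thesis by (simp add: semidirect_simps cong_def add.commute)
qed

text \<open>The product is that of the ambient \<open>M\<close>, so the pairs from several subgroups
  can be compared as subsets of one set.\<close>

definition commuting_pairs :: "('a, 'b) monoid_scheme \<Rightarrow> 'a set \<Rightarrow> ('a \<times> 'a) set"
  where "commuting_pairs M X = {(x, y). x \<in> X \<and> y \<in> X \<and> x \<otimes>\<^bsub>M\<^esub> y = y \<otimes>\<^bsub>M\<^esub> x}"

text \<open>Conjugating \<open>(0, j)\<close> by \<open>(t, 0)\<close> gives \<open>(t (1 - \<phi>\<^sup>j), j)\<close>. The centralizer of an element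
  outside the abelian normal subgroup given by \<open>r dvd j\<close> is one of the \<open>q\<close> conjugates of the
  complement; the conjugating \<open>t\<close> is unique because \<open>1 - \<phi>\<^sup>j\<close> is invertible modulo \<open>q\<close>.\<close>

lemma bij_betw_commuting_pairs:
  fixes q p r :: nat and \<phi> :: int
  assumes q: "prime q" and r: "\<And>d. [\<phi> ^ d = 1] (mod int q) \<longleftrightarrow> r dvd d"
  shows "bij_betw (\<lambda>(t, j, l). ((t * (1 - \<phi> ^ j) mod int q, j), (t * (1 - \<phi> ^ l) mod int q, l)))
    ({0..<int q} \<times> {(j, l). j < p \<and> l < p \<and> \<not> (r dvd j \<and> r dvd l)})
    {(x, y). (x, y) \<in> commuting_pairs (semidirect q p \<phi>) ({0..<int q} \<times> {0..<p}) \<and>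
       \<not> (r dvd snd x \<and> r dvd snd y)}" (is "bij_betw ?f ?U ?C")
proof -
  have q0: "0 < int q" using q prime_gt_0_nat by simp
  \<comment> \<open>The prime \<open>q\<close> does not divide \<open>\<phi> ^ j - 1\<close>, by the
    hypothesis on \<open>r\<close>.\<close>
  have cop: "coprime (1 - \<phi> ^ j) (int q)" if "\<not> r dvd j" for j
  proof -
    have "\<not> int q dvd \<phi> ^ j - 1" using r[of j] that by (simp add: cong_iff_dvd_diff)
    then have "\<not> int q dvd 1 - \<phi> ^ j" by (simp add: dvd_diff_commute)
    then show ?thesis using q by (simp add: coprime_commute prime_imp_coprime)
  qed
  have cancel: "x = y" if "[x * (1 - \<phi> ^ j) = y * (1 - \<phi> ^ j)] (mod int q)" "\<not> r dvd j"
    "x \<in> {0..<int q}" "y \<in> {0..<int q}" for x y j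
    using that cong_mult_rcancel[OF cop[OF that(2)]] cong_less_imp_eq_int by auto
  have solve: "\<exists>t\<in>{0..<int q}. i = t * (1 - \<phi> ^ j) mod int q \<and> k = t * (1 - \<phi> ^ l) mod int q"
    if j: "\<not> r dvd j" and ik: "i \<in> {0..<int q}" "k \<in> {0..<int q}"
      and eq: "[i * (1 - \<phi> ^ l) = k * (1 - \<phi> ^ j)] (mod int q)" for i j k l
  proof -
    obtain z where z: "[(1 - \<phi> ^ j) * z = 1] (mod int q)"
      using cong_solve_coprime_int[OF cop[OF j]] by blast
    \<comment> \<open>As \<open>z\<close> inverts \<open>1 - \<phi> ^ j\<close> modulo
      \<open>q\<close>, the first element forces this value. The commutation congruence then yields
      the equation for the second element after cancelling \<open>1 - \<phi> ^ j\<close>.\<close>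
    define t where "t = (i * z) mod int q"
    have t: "[t = i * z] (mod int q)" by (simp add: t_def cong_def)
    have "[t * (1 - \<phi> ^ j) = i * ((1 - \<phi> ^ j) * z)] (mod int q)"
      using cong_scalar_right[OF t, of "1 - \<phi> ^ j"] by (simp only: mult_ac)
    also have "[i * ((1 - \<phi> ^ j) * z) = i * 1] (mod int q)" by (rule cong_scalar_left[OF z])
    finally have i: "[t * (1 - \<phi> ^ j) = i] (mod int q)" by simp
    have "[(t * (1 - \<phi> ^ l)) * (1 - \<phi> ^ j) = i * (1 - \<phi> ^ l)] (mod int q)"
      using cong_scalar_right[OF i, of "1 - \<phi> ^ l"] by (simp only: mult_ac)
    also note eq
    finally have k: "[t * (1 - \<phi> ^ l) = k] (mod int q)"
      using cong_mult_rcancel[OF cop[OF j]] by blast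
    have "t \<in> {0..<int q}" using q0 by (simp add: t_def)
    with i k ik show ?thesis by (auto simp: cong_def intro!: bexI[of _ t])
  qed
  show ?thesis
  proof (rule bij_betw_imageI)
    show "inj_on ?f ?U"
    proof (rule inj_onI)
      fix u v assume u: "u \<in> ?U" and v: "v \<in> ?U" and eq: "?f u = ?f v"
      obtain t j l t' j' l' where uv: "u = (t, j, l)" "v = (t', j', l')" by (metis surj_pair)
      have jl: "j' = j" "l' = l" using eq uv by auto
      have t: "t \<in> {0..<int q}" "t' \<in> {0..<int q}" and n: "\<not> r dvd j \<or> \<not> r dvd l"
        using u v uv by auto
      have "[t * (1 - \<phi> ^ j) = t' * (1 - \<phi> ^ j)] (mod int q)"
        "[t * (1 - \<phi> ^ l) = t' * (1 - \<phi> ^ l)] (mod int q)"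
        using eq uv jl by (auto simp: cong_def)
      \<comment> \<open>Cancellation takes place in whichever of the two exponents is not divisible
        by \<open>r\<close>.\<close>
      then have "t = t'" using cancel[OF _ _ t] n by blast
      then show "u = v" using uv jl by simp
    qed
    show "?f ` ?U = ?C"
    proof (intro equalityI subsetI)
      fix z assume "z \<in> ?f ` ?U"
      then obtain t j l where z: "z = ((t * (1 - \<phi> ^ j) mod int q, j), (t * (1 - \<phi> ^ l) mod int q, l))"
        "j < p" "l < p" "\<not> (r dvd j \<and> r dvd l)" by auto
      have "[t * (1 - \<phi> ^ j) mod int q * (1 - \<phi> ^ l) = t * (1 - \<phi> ^ l) mod int q * (1 - \<phi> ^ j)] (mod int q)"
        by (simp add: cong_def mod_simps mult_ac)
      with z q0 show "z \<in> ?C"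
        by (simp add: commuting_pairs_def semidirect_commute_iff)
    next
      fix z assume z: "z \<in> ?C"
      obtain i j k l where ijkl: "z = ((i, j), (k, l))" by (metis surj_pair)
      have b: "i \<in> {0..<int q}" "k \<in> {0..<int q}" "j < p" "l < p"
        and n: "\<not> (r dvd j \<and> r dvd l)"
        and eq: "[i * (1 - \<phi> ^ l) = k * (1 - \<phi> ^ j)] (mod int q)"
        using z by (auto simp: ijkl commuting_pairs_def semidirect_commute_iff)
      \<comment> \<open>If \<open>r\<close> divides \<open>j\<close>, the two elements exchange
        their roles.\<close>
      have "\<exists>t\<in>{0..<int q}. i = t * (1 - \<phi> ^ j) mod int q \<and> k = t * (1 - \<phi> ^ l) mod int q"
        using n solve[OF _ b(1,2) eq] solve[OF _ b(2,1) cong_sym[OF eq]] by blast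
      then obtain t where "t \<in> {0..<int q}" "z = ?f (t, j, l)" by (auto simp: ijkl)
      with b n show "z \<in> ?f ` ?U" by (intro image_eqI[of _ _ "(t, j, l)"]) auto
    qed
  qed
qed

text \<open>Multiplication by \<open>r\<close> matches these multiples with the numbers below
  \<open>p div r\<close>; the count is the order of the subgroup generated by
  \<open>B\<close>.\<close>

lemma card_multiples_below:
  assumes "r dvd p" "0 < (r::nat)"
  shows "card {j. j < p \<and> r dvd j} = p div r"
proof -
  have "{j. j < p \<and> r dvd j} = (*) r ` {..<p div r}"
    using assms by (auto elim!: dvdE)
  then show ?thesis using assms by (simp add: card_image inj_on_def)
qed

text \<open>Pairs with both exponents divisible by \<open>r\<close> form the first term. All others
  are conjugates by \<open>(t, 0)\<close> of pairs in the complement, so by invariance each of the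
  \<open>q\<close> values of \<open>t\<close> contributes the same sum: all pairs of exponents minus
  those with both divisible by \<open>r\<close>.\<close>

lemma sum_commuting_pairs_semidirect:
  fixes q p r :: nat and \<phi> :: int and T :: "int \<times> nat \<Rightarrow> int \<times> nat \<Rightarrow> complex"
  assumes q: "prime q" and r: "\<And>d. [\<phi> ^ d = 1] (mod int q) \<longleftrightarrow> r dvd d"
    and T: "\<And>t j l. t \<in> {0..<int q} \<Longrightarrow> j < p \<Longrightarrow> l < p \<Longrightarrow>
      T (t * (1 - \<phi> ^ j) mod int q, j) (t * (1 - \<phi> ^ l) mod int q, l) = T (0, j) (0, l)"
  defines "F X \<equiv> \<Sum>(x, y)\<in>commuting_pairs (semidirect q p \<phi>) X. T x y"
  shows "F ({0..<int q} \<times> {0..<p}) = F ({0..<int q} \<times> {j. j < p \<and> r dvd j})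
    + of_nat q * (F ({0} \<times> {0..<p}) - F ({0} \<times> {j. j < p \<and> r dvd j}))"
proof -
  let ?C = "{(x, y). (x, y) \<in> commuting_pairs (semidirect q p \<phi>) ({0..<int q} \<times> {0..<p}) \<and>
       \<not> (r dvd snd x \<and> r dvd snd y)}"
  let ?D = "{(j, l). j < p \<and> l < p \<and> \<not> (r dvd j \<and> r dvd l)}"
  let ?E = "{j. j < p \<and> r dvd j} \<times> {j. j < p \<and> r dvd j}"
  have fin: "finite (commuting_pairs (semidirect q p \<phi>) X)" if "finite X" for X
    by (rule finite_subset[of _ "X \<times> X"]) (use that in \<open>auto simp: commuting_pairs_def\<close>)
  \<comment> \<open>With zero first components the commutation congruence reads
    \<open>0 = 0\<close>, so any two exponents give a commuting pair.\<close>
  have complement: "F ({0} \<times> J) = (\<Sum>(j, l)\<in>J \<times> J. T (0, j) (0, l))" for J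
    unfolding F_def
    by (rule sum.reindex_bij_witness[of _ "\<lambda>(j, l). ((0, j), (0, l))" "\<lambda>(x, y). (snd x, snd y)"])
      (auto simp: commuting_pairs_def semidirect_commute_iff)
  have split1: "commuting_pairs (semidirect q p \<phi>) ({0..<int q} \<times> {0..<p})
      = commuting_pairs (semidirect q p \<phi>) ({0..<int q} \<times> {j. j < p \<and> r dvd j}) \<union> ?C"
    by (auto simp: commuting_pairs_def)
  have "F ({0..<int q} \<times> {0..<p}) = F ({0..<int q} \<times> {j. j < p \<and> r dvd j}) + (\<Sum>(x, y)\<in>?C. T x y)"
  proof -
    have "finite ?C" by (rule finite_subset[OF _ fin[of "{0..<int q} \<times> {0..<p}"]]) auto
    moreover have "finite (commuting_pairs (semidirect q p \<phi>) ({0..<int q} \<times> {j. j < p \<and> r dvd j}))"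
      by (rule fin) auto
    moreover have "commuting_pairs (semidirect q p \<phi>) ({0..<int q} \<times> {j. j < p \<and> r dvd j}) \<inter> ?C = {}"
      by (auto simp: commuting_pairs_def)
    ultimately show ?thesis
      unfolding F_def by (subst sum.cong[OF split1 refl]) (rule sum.union_disjoint)
  qed
  also have "(\<Sum>(x, y)\<in>?C. T x y) = (\<Sum>(t, j, l)\<in>{0..<int q} \<times> ?D. T (0, j) (0, l))"
  proof -
    have "(\<Sum>(x, y)\<in>?C. T x y) = (\<Sum>u\<in>{0..<int q} \<times> ?D. case (\<lambda>(t, j, l).
        ((t * (1 - \<phi> ^ j) mod int q, j), (t * (1 - \<phi> ^ l) mod int q, l))) u of (x, y) \<Rightarrow> T x y)"
      by (rule sum.reindex_bij_betw[OF bij_betw_commuting_pairs[OF q r], symmetric])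
    also have "\<dots> = (\<Sum>(t, j, l)\<in>{0..<int q} \<times> ?D. T (0, j) (0, l))"
      by (rule sum.cong[OF refl]) (use T in \<open>auto split: prod.splits\<close>)
    finally show ?thesis .
  qed
  also have "\<dots> = (\<Sum>t\<in>{0..<int q}. \<Sum>(j, l)\<in>?D. T (0, j) (0, l))"
    by (rule sum.cartesian_product[symmetric])
  also have "\<dots> = of_nat q * (\<Sum>(j, l)\<in>?D. T (0, j) (0, l))"
    by simp
  also have "(\<Sum>(j, l)\<in>?D. T (0, j) (0, l))
      = (\<Sum>(j, l)\<in>{0..<p} \<times> {0..<p}. T (0, j) (0, l)) - (\<Sum>(j, l)\<in>?E. T (0, j) (0, l))"
  proof -
    have D: "?D = {0..<p} \<times> {0..<p} - ?E" by auto
    have "?E \<subseteq> {0..<p} \<times> {0..<p}" by auto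
    then show ?thesis unfolding D by (intro sum_diff) auto
  qed
  finally show ?thesis by (simp add: complement)
qed

section \<open>Finite groups of automorphisms\<close>

lemma voa_aut_inv:
  assumes "\<sigma> \<in> voa_aut V"
  shows "inv_into UNIV \<sigma> \<in> voa_aut V"
proof -
  have \<sigma>: "clinear_on UNIV \<sigma>" "bij \<sigma>" "\<sigma> (vac V) = vac V" "\<sigma> (conf V) = conf V"
    "\<And>u n v. \<sigma> (mode V u n v) = mode V (\<sigma> u) n (\<sigma> v)"
    using assms by (auto simp: voa_aut_def)
  \<comment> \<open>Each law for the inverse map turns into the law for \<sigma> once \<sigma> is
    applied to both sides.\<close>
  have inv: "inv_into UNIV \<sigma> x = y \<longleftrightarrow> x = \<sigma> y" for x y
    using bij_inv_eq_iff[OF \<sigma>(2)] by metis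
  have \<sigma>_inv: "\<sigma> (inv_into UNIV \<sigma> x) = x" for x
    using \<sigma>(2) by (simp add: bij_is_surj surj_f_inv_f)
  show ?thesis
    unfolding voa_aut_def clinear_on_def
    using \<sigma> by (simp add: bij_imp_bij_inv inv \<sigma>_inv clinear_on_add clinear_on_scale)
qed

lemma group_Aut_group: "group (Aut_group V)"
proof (rule groupI)
  fix \<sigma> assume \<sigma>: "\<sigma> \<in> carrier (Aut_group V)"
  then have "inv_into UNIV \<sigma> \<circ> \<sigma> = id"
    by (auto simp: Aut_group_def voa_aut_def bij_is_inj)
  with \<sigma> show "\<exists>\<tau>\<in>carrier (Aut_group V). \<tau> \<otimes>\<^bsub>Aut_group V\<^esub> \<sigma> = \<one>\<^bsub>Aut_group V\<^esub>"
    using voa_aut_inv by (auto simp: Aut_group_def)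
qed (auto simp: Aut_group_def voa_aut_def clinear_on_def bij_comp comp_assoc)

lemma finite_bijection_group_subgroup:
  assumes H: "subgroup H (Aut_group V)" and fin: "finite H"
  shows "finite_bijection_group H"
proof
  interpret group "Aut_group V" by (rule group_Aut_group)
  interpret subgroup H "Aut_group V" by (rule H)
  have aut: "g \<in> voa_aut V" if "g \<in> H" for g
    using subset that by (auto simp: Aut_group_def)
  show "finite H" by fact
  show bij: "bij g" if "g \<in> H" for g
    using aut[OF that] by (simp add: voa_aut_def)
  show "id \<in> H" using one_closed by (simp add: Aut_group_def)
  show "g \<circ> h \<in> H" if "g \<in> H" "h \<in> H" for g h
    using m_closed[OF that] by (simp add: Aut_group_def)
  show "inv_into UNIV g \<in> H" if g: "g \<in> H" for g
  proof -
    have "inv\<^bsub>Aut_group V\<^esub> g = inv_into UNIV g"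
      by (rule inv_equality)
        (use aut[OF g] voa_aut_inv bij_is_inj[OF bij[OF g]] in \<open>auto simp: Aut_group_def\<close>)
    then show ?thesis using m_inv_closed[OF g] by simp
  qed
qed

text \<open>In a finite group the natural powers of an element already form a subgroup. As
  \<open>Aut_group V\<close> may be infinite, the generated subgroup is first computed inside
  \<open>G\<close>.\<close>

lemma generate_Aut_group:
  assumes G: "subgroup G (Aut_group V)" "finite G" and x: "x \<in> G"
  shows "generate (Aut_group V) {x} = range (\<lambda>n. x ^^ n)"
proof -
  let ?M = "(Aut_group V)\<lparr>carrier := G\<rparr>"
  interpret M: group ?M by (rule group.subgroup_imp_group[OF group_Aut_group G(1)])
  have pow: "x [^]\<^bsub>?M\<^esub> n = x ^^ n" for n :: nat
  proof (induction n)
    case (Suc n)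
    then show ?case by (simp add: Aut_group_def funpow_Suc_right del: funpow.simps)
  qed (simp add: Aut_group_def)
  have "generate (Aut_group V) {x} = generate ?M {x}"
    using group.generate_consistent[OF group_Aut_group _ G(1), of "{x}"] x by simp
  also have "\<dots> = range (\<lambda>n. x ^^ n)"
    using M.generate_pow_on_finite_carrier[of x] G(2) x pow by auto
  finally show ?thesis .
qed

text \<open>The common form of characters and graded dimensions: \<open>T\<close> is a twining
  character in one case and the trace on a weight space in the other.\<close>

definition class_average ::
    "(('v \<Rightarrow> 'v) \<Rightarrow> ('v \<Rightarrow> 'v) \<Rightarrow> complex) \<Rightarrow> ('v \<Rightarrow> 'v) set \<Rightarrow> complex"
  where "class_average T H =
    (\<Sum>g\<in>class_reps H. 1 / of_nat (card (centralizer H g)) * (\<Sum>h\<in>centralizer H g. T g h))"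

text \<open>In coordinates the four groups are products of a set of first components and a set of
  exponents. The identity between their sums over commuting pairs, divided by the order of
  \<open>G\<close>, gives the formula.\<close>

lemma class_average_semidirect:
  fixes V :: "'v::complex_vector voa" and q p r :: nat and \<phi> :: int
    and T :: "('v \<Rightarrow> 'v) \<Rightarrow> ('v \<Rightarrow> 'v) \<Rightarrow> complex"
  assumes q: "prime q" and p: "0 < p" "coprime p q"
    and phi: "\<not> [\<phi> = 1] (mod int q)" "[\<phi> ^ p = 1] (mod int q)"
    and r: "r = (LEAST d. d dvd p \<and> [\<phi> ^ d = 1] (mod int q))"
    and G: "subgroup G (Aut_group V)"
    and iota: "\<iota> \<in> iso (semidirect q p \<phi>) ((Aut_group V)\<lparr>carrier := G\<rparr>)"
    and a: "a = \<iota> (1, 0)" and A: "A = \<iota> (0, 1)" and B: "B = A ^^ r"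
    and T: "\<And>k g h. k \<in> G \<Longrightarrow> g \<in> G \<Longrightarrow> h \<in> centralizer G g \<Longrightarrow>
      T (conj_by k g) (conj_by k h) = T g h"
  shows "class_average T G = class_average T (generate (Aut_group V) {A})
    - 1 / of_nat r * (class_average T (generate (Aut_group V) {B})
      - class_average T (generate (Aut_group V) {a \<circ> B}))"
proof -
  have q2: "2 \<le> q" using q prime_ge_2_nat by blast
  have r_dvd: "[\<phi> ^ d = 1] (mod int q) \<longleftrightarrow> r dvd d" for d
    using multiplicative_order(1)[OF p(1) phi(2) _ r] q2 by simp
  have rp: "r dvd p" and r0: "0 < r"
    using multiplicative_order(2,3)[OF p(1) phi(2) _ r] q2 by simp_all
  \<comment> \<open>For \<open>p = 1\<close> the two conditions on \<phi> contradict each other.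
    Hence \<open>(0, 1)\<close> lies in the carrier of the semidirect product.\<close>
  have p2: "2 \<le> p"
  proof -
    have "p \<noteq> 1" using phi by auto
    with p(1) show ?thesis by simp
  qed
  have pr: "r * (p div r) = p" using rp by simp
  define S where "S = {0..<int q} \<times> {0..<p}"
  define J where "J = {j. j < p \<and> r dvd j}"
  have bij_iota: "bij_betw \<iota> S G"
    and mult: "\<And>x y. x \<in> S \<Longrightarrow> y \<in> S \<Longrightarrow> \<iota> (x \<otimes>\<^bsub>semidirect q p \<phi>\<^esub> y) = \<iota> x \<circ> \<iota> y"
    using iota by (auto simp: iso_def hom_def S_def semidirect_simps Aut_group_def)
  have in_S: "(i, j) \<in> S \<longleftrightarrow> 0 \<le> i \<and> i < int q \<and> j < p" for i j
    by (auto simp: S_def)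
  have G_eq: "G = \<iota> ` S" and inj: "inj_on \<iota> S"
    using bij_iota by (auto simp: bij_betw_def)
  have finG: "finite G" by (simp add: G_eq S_def)
  interpret G: finite_bijection_group G
    by (rule finite_bijection_group_subgroup[OF G finG])
  \<comment> \<open>An injective idempotent map is the identity.\<close>
  have iota_one: "\<iota> (0, 0) = id"
  proof -
    have S0: "(0, 0) \<in> S" using q2 p2 by (simp add: in_S)
    have "\<iota> (0, 0) \<circ> \<iota> (0, 0) = \<iota> (0, 0)"
      using mult[OF S0 S0] p2 q2 by (simp add: semidirect_simps)
    moreover have "inj (\<iota> (0, 0))"
      using S0 G_eq by (intro bij_is_inj G.bij) blast
    ultimately show ?thesis by (simp add: fun_eq_iff inj_eq)
  qed
  \<comment> \<open>Under either condition \<open>\<phi> ^ j\<close> acts trivially on the multiples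
    of \<open>i\<close>, so powers are taken componentwise. This covers \<open>A\<close>,
    \<open>B\<close> and \<open>a \<circ> B\<close>.\<close>
  have pow: "\<iota> (i, j) ^^ n = \<iota> (int n * i mod int q, n * j mod p)"
    if S: "(i, j) \<in> S" and ij: "i = 0 \<or> r dvd j" for i j n
  proof (induction n)
    case 0
    show ?case by (simp add: iota_one)
  next
    case (Suc n)
    have S': "(int n * i mod int q, n * j mod p) \<in> S" using q2 p2 by (simp add: in_S)
    have "[\<phi> ^ j * (int n * i mod int q) = int n * i] (mod int q)"
    proof (cases "i = 0")
      case False
      then have "[\<phi> ^ j = 1] (mod int q)" using ij r_dvd by simp
      then have "[\<phi> ^ j * (int n * i mod int q) = 1 * (int n * i)] (mod int q)"
        by (rule cong_mult) (simp add: cong_def)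
      then show ?thesis by simp
    qed simp
    then have "(i + \<phi> ^ j * (int n * i mod int q)) mod int q = int (Suc n) * i mod int q"
      using cong_add_lcancel[of i] by (simp add: cong_def distrib_right)
    moreover have "(j + n * j mod p) mod p = Suc n * j mod p" by (simp add: mod_simps)
    ultimately show ?case
      using Suc mult[OF S S'] by (simp add: semidirect_simps)
  qed
  have gen: "generate (Aut_group V) {\<iota> (i, j)} = \<iota> ` range (\<lambda>n. (int n * i mod int q, n * j mod p))"
    if "(i, j) \<in> S" "i = 0 \<or> r dvd j" for i j
    using generate_Aut_group[OF G finG, of "\<iota> (i, j)"] pow[OF that] that(1) G_eq by (simp add: image_image)
  \<comment> \<open>The exponent is reduced because \<open>r = p\<close> is possible, and then
    \<open>B\<close> is the identity.\<close>
  have B': "B = \<iota> (0, r mod p)"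
    using pow[of 0 1 r] q2 p2 by (simp add: A B in_S)
  have aB: "a \<circ> B = \<iota> (1, r mod p)"
    using mult[of "(1, 0)" "(0, r mod p)"] q2 p2 by (simp add: a B' in_S semidirect_simps)

  \<comment> \<open>The three cyclic subgroups in coordinates\<close>
  have genA: "generate (Aut_group V) {A} = \<iota> ` ({0} \<times> {0..<p})"
  proof -
    have "range (\<lambda>n. (int n * 0 mod int q, n * 1 mod p)) = {0} \<times> {0..<p}"
    proof (intro equalityI subsetI)
      fix z :: "int \<times> nat" assume "z \<in> {0} \<times> {0..<p}"
      then show "z \<in> range (\<lambda>n. (int n * 0 mod int q, n * 1 mod p))"
        by (intro image_eqI[of _ _ "snd z"]) auto
    qed (use p2 in auto)
    then show ?thesis using gen[of 0 1] p2 q2 by (simp add: A in_S)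
  qed
  have r_mod: "r dvd r mod p" using rp by (simp add: dvd_mod)
  have genB: "generate (Aut_group V) {B} = \<iota> ` ({0} \<times> J)"
  proof -
    have "range (\<lambda>n. (int n * 0 mod int q, n * (r mod p) mod p)) = {0} \<times> J"
    proof (intro equalityI subsetI)
      fix z assume "z \<in> range (\<lambda>n. (int n * 0 mod int q, n * (r mod p) mod p))"
      then show "z \<in> {0} \<times> J" using p2 rp by (auto simp: J_def mod_simps dvd_mod)
    next
      fix z :: "int \<times> nat" assume "z \<in> {0} \<times> J"
      then obtain c where "z = (0, r * c)" "r * c < p" by (auto simp: J_def)
      then show "z \<in> range (\<lambda>n. (int n * 0 mod int q, n * (r mod p) mod p))"
        by (intro image_eqI[of _ _ c]) (auto simp: mod_simps mult.commute)
    qed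
    then show ?thesis using gen[of 0 "r mod p"] p2 q2 by (simp add: B' in_S)
  qed
  have genaB: "generate (Aut_group V) {a \<circ> B} = \<iota> ` ({0..<int q} \<times> J)"
  proof -
    have "range (\<lambda>n. (int n * 1 mod int q, n * (r mod p) mod p)) = {0..<int q} \<times> J"
    proof (intro equalityI subsetI)
      fix z assume "z \<in> range (\<lambda>n. (int n * 1 mod int q, n * (r mod p) mod p))"
      then show "z \<in> {0..<int q} \<times> J" using p2 q2 rp by (auto simp: J_def mod_simps dvd_mod)
    next
      fix z assume "z \<in> {0..<int q} \<times> J"
      then obtain i j where "z = (i, j)" "j < p" "r dvd j" "0 \<le> i" "i < int q"
        by (auto simp: J_def)
      then obtain c where z: "z = (i, r * c)" "r * c < p" "0 \<le> i" "i < int q"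
        by (metis dvdE)
      \<comment> \<open>By the Chinese remainder theorem some power of \<open>a \<circ> B\<close>
        has both prescribed components; this is where coprimality of \<open>p\<close> and
        \<open>q\<close> enters.\<close>
      have "coprime q (p div r)"
        using p(2) pr by (metis coprime_commute coprime_mult_right_iff)
      then obtain n where n: "[n = nat i] (mod q)" "[n = c] (mod p div r)"
        using binary_chinese_remainder_nat by blast
      have "int n mod int q = i"
        using cong_int_iff[of n "nat i" q] n(1) z by (simp add: cong_def)
      moreover have "n * (r mod p) mod p = r * c"
      proof -
        have "n * (r mod p) mod p = r * (n mod (p div r))"
          using mult_mod_right[of r n "p div r"] by (simp add: pr mod_simps mult.commute)
        also have "n mod (p div r) = c mod (p div r)" using n(2) by (simp add: cong_def)
        also have "r * (c mod (p div r)) = r * c"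
          using z(2) pr mult_mod_right[of r c "p div r"] by simp
        finally show ?thesis .
      qed
      ultimately show "z \<in> range (\<lambda>n. (int n * 1 mod int q, n * (r mod p) mod p))"
        using z by (intro image_eqI[of _ _ n]) auto
    qed
    then show ?thesis using gen[of 1 "r mod p"] r_mod p2 q2 by (simp add: aB in_S)
  qed

  \<comment> \<open>Class averages as sums over commuting pairs\<close>
  define F where "F X = (\<Sum>(x, y)\<in>commuting_pairs (semidirect q p \<phi>) X. T (\<iota> x) (\<iota> y))" for X
  have average: "class_average T (\<iota> ` X) = 1 / of_nat (card X) * F X"
    if X: "X \<subseteq> S" and H: "subgroup (\<iota> ` X) (Aut_group V)" for X
  proof -
    have HG: "\<iota> ` X \<subseteq> G" using X G_eq by auto
    then have finH: "finite (\<iota> ` X)" using finG by (rule finite_subset)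
    interpret H: finite_bijection_group "\<iota> ` X"
      by (rule finite_bijection_group_subgroup[OF H finH])
    have injX: "inj_on \<iota> X" using inj X inj_on_subset by blast
    \<comment> \<open>Injectivity of \<iota> makes commuting in \<open>G\<close> the same as
      commuting in the semidirect product.\<close>
    have comm: "\<iota> y \<circ> \<iota> x = \<iota> x \<circ> \<iota> y
        \<longleftrightarrow> x \<otimes>\<^bsub>semidirect q p \<phi>\<^esub> y = y \<otimes>\<^bsub>semidirect q p \<phi>\<^esub> x" if "x \<in> X" "y \<in> X" for x y
    proof -
      have "x \<otimes>\<^bsub>semidirect q p \<phi>\<^esub> y \<in> S" "y \<otimes>\<^bsub>semidirect q p \<phi>\<^esub> x \<in> S"
        using q2 p2 by (cases x; cases y; simp add: semidirect_simps in_S)+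
      moreover have "x \<in> S" "y \<in> S" using that X by auto
      ultimately show ?thesis
        using mult[of x y] mult[of y x] inj_on_eq_iff[OF inj] by metis
    qed
    have "(\<Sum>g\<in>\<iota> ` X. \<Sum>h\<in>centralizer (\<iota> ` X) g. T g h)
        = (\<Sum>(g, h)\<in>Sigma (\<iota> ` X) (centralizer (\<iota> ` X)). T g h)"
      using finH by (intro sum.Sigma) (auto simp: centralizer_def)
    also have "Sigma (\<iota> ` X) (centralizer (\<iota> ` X))
        = (\<lambda>(x, y). (\<iota> x, \<iota> y)) ` commuting_pairs (semidirect q p \<phi>) X"
      using comm by (force simp: centralizer_def commuting_pairs_def)
    also have "(\<Sum>(g, h)\<in>\<dots>. T g h) = F X"
      unfolding F_def
      by (subst sum.reindex) (use injX in \<open>auto simp: inj_on_def commuting_pairs_def case_prod_unfold\<close>)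
    finally have F: "(\<Sum>g\<in>\<iota> ` X. \<Sum>h\<in>centralizer (\<iota> ` X) g. T g h) = F X" .
    have "class_average T (\<iota> ` X)
        = 1 / of_nat (card (\<iota> ` X)) * (\<Sum>g\<in>\<iota> ` X. \<Sum>h\<in>centralizer (\<iota> ` X) g. T g h)"
      unfolding class_average_def
    proof (rule H.centralizer_average)
      fix k g h assume "k \<in> \<iota> ` X" "g \<in> \<iota> ` X" "h \<in> centralizer (\<iota> ` X) g"
      then have "k \<in> G" "g \<in> G" "h \<in> centralizer G g" using HG by (auto simp: centralizer_def)
      then show "T (conj_by k g) (conj_by k h) = T g h" by (rule T)
    qed
    then show ?thesis by (simp add: F card_image[OF injX])
  qed
  have gen_sub: "subgroup (generate (Aut_group V) {x}) (Aut_group V)" if "x \<in> G" for x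
    using group.generate_is_subgroup[OF group_Aut_group] that subgroup.subset[OF G] by blast
  have mem: "A \<in> G" "B \<in> G" "a \<circ> B \<in> G"
    unfolding aB unfolding A B' G_eq using p2 q2 by (auto simp: in_S intro!: imageI)
  have sub: "{0} \<times> {0..<p} \<subseteq> S" "{0} \<times> J \<subseteq> S" "{0..<int q} \<times> J \<subseteq> S"
    using q2 by (auto simp: S_def J_def)
  have cardJ: "card J = p div r"
    unfolding J_def by (rule card_multiples_below[OF rp r0])
  have cards: "card ({0::int} \<times> J) = p div r" "card ({0..<int q} \<times> J) = q * (p div r)"
    by (simp_all only: card_cartesian_product cardJ) simp_all
  have of_nat_pr: "(of_nat (p div r) :: complex) = of_nat p / of_nat r"
    using r0 by (subst (2) pr[symmetric]) (simp del: pr)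
  have F_S: "F S = F ({0..<int q} \<times> J) + of_nat q * (F ({0} \<times> {0..<p}) - F ({0} \<times> J))"
    unfolding F_def S_def J_def
  proof (rule sum_commuting_pairs_semidirect[OF q r_dvd])
    fix t :: int and j l assume t: "t \<in> {0..<int q}" and j: "j < p" and l: "l < p"
    \<comment> \<open>Moving the conjugating element to the other side leaves an identity between
      products in the semidirect product, without inverses.\<close>
    have conj: "conj_by (\<iota> (t, 0)) (\<iota> (0, j)) = \<iota> (t * (1 - \<phi> ^ j) mod int q, j)" if "j < p" for j
    proof -
      let ?x = "(t * (1 - \<phi> ^ j) mod int q, j)"
      have S: "(t, 0) \<in> S" "(0, j) \<in> S" "?x \<in> S" using t that q2 p2 by (auto simp: in_S)
      have "(t, 0) \<otimes>\<^bsub>semidirect q p \<phi>\<^esub> (0, j) = ?x \<otimes>\<^bsub>semidirect q p \<phi>\<^esub> (t, 0)"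
        using t that by (simp add: semidirect_simps mod_simps algebra_simps)
      then have "\<iota> (t, 0) \<circ> \<iota> (0, j) = \<iota> ?x \<circ> \<iota> (t, 0)"
        using mult S by metis
      moreover have "bij (\<iota> (t, 0))" using S(1) G_eq G.bij by blast
      ultimately show ?thesis by (simp add: conj_by_eq_iff)
    qed
    have S: "(t, 0) \<in> S" "(0, j) \<in> S" "(0, l) \<in> S" using t j l q2 p2 by (auto simp: in_S)
    have "\<iota> (0, l) \<circ> \<iota> (0, j) = \<iota> (0, j) \<circ> \<iota> (0, l)"
      using mult[OF S(2,3)] mult[OF S(3,2)] by (simp add: semidirect_simps add.commute)
    then have "\<iota> (0, l) \<in> centralizer G (\<iota> (0, j))"
      using S G_eq by (auto simp: centralizer_def)
    then show "T (\<iota> (t * (1 - \<phi> ^ j) mod int q, j)) (\<iota> (t * (1 - \<phi> ^ l) mod int q, l))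
        = T (\<iota> (0, j)) (\<iota> (0, l))"
      using T[of "\<iota> (t, 0)" "\<iota> (0, j)" "\<iota> (0, l)"] conj j l S G_eq by auto
  qed
  have avG: "class_average T G = 1 / (of_nat q * of_nat p) * F S"
    using average[of S] G G_eq by (simp add: S_def)
  have avA: "class_average T (generate (Aut_group V) {A}) = 1 / of_nat p * F ({0} \<times> {0..<p})"
    using average[OF sub(1)] gen_sub[OF mem(1)] by (simp add: genA)
  have avB: "class_average T (generate (Aut_group V) {B}) = of_nat r / of_nat p * F ({0} \<times> J)"
    using average[OF sub(2)] gen_sub[OF mem(2)] unfolding genB cards of_nat_pr by simp
  have avaB: "class_average T (generate (Aut_group V) {a \<circ> B})
      = of_nat r / (of_nat q * of_nat p) * F ({0..<int q} \<times> J)"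
    using average[OF sub(3)] gen_sub[OF mem(3)]
    unfolding genaB cards of_nat_mult of_nat_pr by simp
  \<comment> \<open>The factor \<open>1 / r\<close> comes from two subgroups of index
    \<open>r\<close>: the one generated by \<open>a \<circ> B\<close> in \<open>G\<close>, and the
    one generated by \<open>B\<close> in that generated by \<open>A\<close>.\<close>
  show ?thesis
    unfolding avG avA avB avaB F_S using q2 p2 r0 by (simp add: field_simps)
qed

section \<open>Characters of the orbifolds\<close>

text \<open>Isolates the data from which traces are computed: twisted modules for the elements of a
  finite \<open>G\<close>, and maps between them that compose strictly, so that centralizers are
  represented linearly.\<close>

locale twisted_sectors =
  fixes V :: "'v::complex_vector voa"
    and W :: "('v \<Rightarrow> 'v) \<Rightarrow> ('v, 'w::complex_vector) vmodule"
    and \<Phi> :: "('v \<Rightarrow> 'v) \<Rightarrow> ('v \<Rightarrow> 'v) \<Rightarrow> 'w \<Rightarrow> 'w"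
    and G :: "('v \<Rightarrow> 'v) set"
  assumes G: "subgroup G (Aut_group V)" and finite_G: "finite G"
    and W: "g \<in> G \<Longrightarrow> twisted_module V g (W g)"
    and twist: "twist_action G W \<Phi>" and linear: "linear_action G W \<Phi>"
begin

sublocale finite_bijection_group G
  by (rule finite_bijection_group_subgroup[OF G finite_G])

section \<open>Weight spaces and the action on them\<close>

lemma conf_invariant: "k \<in> G \<Longrightarrow> k (conf V) = conf V"
  using subgroup.subset[OF G] by (auto simp: Aut_group_def voa_aut_def)

lemma subspace_mspace: "g \<in> G \<Longrightarrow> cvec.subspace (mspace (W g))"
  and clinear_mact: "g \<in> G \<Longrightarrow> clinear_on (mspace (W g)) (mact (W g) u n)"
  and mact_closed: "g \<in> G \<Longrightarrow> w \<in> mspace (W g) \<Longrightarrow> mact (W g) u n w \<in> mspace (W g)"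
  and finite_dim_mweight: "g \<in> G \<Longrightarrow> finite_dim (mweight V (W g) \<rho>)"
  using W[of g] by (simp_all add: twisted_module_def weak_twisted_module_def)

lemma clinear_Phi: "g \<in> G \<Longrightarrow> k \<in> G \<Longrightarrow> clinear_on (mspace (W g)) (\<Phi> g k)"
  and bij_Phi: "g \<in> G \<Longrightarrow> k \<in> G \<Longrightarrow> bij_betw (\<Phi> g k) (mspace (W g)) (mspace (W (conj_by k g)))"
  and Phi_mact: "g \<in> G \<Longrightarrow> k \<in> G \<Longrightarrow> w \<in> mspace (W g) \<Longrightarrow>
    \<Phi> g k (mact (W g) v n w) = mact (W (conj_by k g)) (k v) n (\<Phi> g k w)"
  using twist unfolding twist_action_def by blast+

lemma Phi_comp: "g \<in> G \<Longrightarrow> k \<in> G \<Longrightarrow> l \<in> G \<Longrightarrow> w \<in> mspace (W g) \<Longrightarrow>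
    \<Phi> (conj_by k g) l (\<Phi> g k w) = \<Phi> g (l \<circ> k) w"
  using linear unfolding linear_action_def by blast

lemma mweight_subset: "mweight V (W g) \<rho> \<subseteq> mspace (W g)"
  by (auto simp: mweight_def)

lemma subspace_mweight:
  assumes "g \<in> G"
  shows "cvec.subspace (mweight V (W g) \<rho>)"
  using subspace_mspace[OF assms] clinear_mact[OF assms, of "conf V" 1]
  by (auto simp: cvec.subspace_def mweight_def clinear_on_add clinear_on_scale
      cvec.scale_right_distrib mult.commute clinear_on_zero)

text \<open>The operator \<open>mact (W g) (conf V) 1\<close> is L(0) on \<open>W g\<close>. As
  \<open>k\<close> fixes the conformal vector, \<open>\<Phi> g k\<close> intertwines the two L(0)
  operators, and being bijective it carries eigenspaces onto eigenspaces.\<close>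

lemma bij_Phi_mweight:
  assumes g: "g \<in> G" and k: "k \<in> G"
  shows "bij_betw (\<Phi> g k) (mweight V (W g) \<rho>) (mweight V (W (conj_by k g)) \<rho>)"
proof (rule bij_betw_imageI)
  have inj: "inj_on (\<Phi> g k) (mspace (W g))" and img: "\<Phi> g k ` mspace (W g) = mspace (W (conj_by k g))"
    using bij_Phi[OF g k] by (auto simp: bij_betw_def)
  have L0: "\<Phi> g k (mact (W g) (conf V) 1 w) = mact (W (conj_by k g)) (conf V) 1 (\<Phi> g k w)"
    if "w \<in> mspace (W g)" for w
    using Phi_mact[OF g k that] conf_invariant[OF k] by simp
  have scale: "\<Phi> g k (\<rho> *\<^sub>C w) = \<rho> *\<^sub>C \<Phi> g k w" if "w \<in> mspace (W g)" for w
    using clinear_on_scale[OF clinear_Phi[OF g k] that] .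
  show "inj_on (\<Phi> g k) (mweight V (W g) \<rho>)"
    using inj mweight_subset inj_on_subset by blast
  have eigen: "\<Phi> g k w \<in> mweight V (W (conj_by k g)) \<rho> \<longleftrightarrow> w \<in> mweight V (W g) \<rho>"
    if w: "w \<in> mspace (W g)" for w
  proof -
    have "\<Phi> g k w \<in> mweight V (W (conj_by k g)) \<rho>
        \<longleftrightarrow> \<Phi> g k (mact (W g) (conf V) 1 w) = \<Phi> g k (\<rho> *\<^sub>C w)"
      using w img by (auto simp: mweight_def L0 scale)
    also have "\<dots> \<longleftrightarrow> mact (W g) (conf V) 1 w = \<rho> *\<^sub>C w"
      by (rule inj_on_eq_iff[OF inj])
        (use w mact_closed[OF g] cvec.subspace_scale[OF subspace_mspace[OF g]] in auto)
    finally show ?thesis using w by (simp add: mweight_def)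
  qed
  show "\<Phi> g k ` mweight V (W g) \<rho> = mweight V (W (conj_by k g)) \<rho>"
  proof (intro equalityI subsetI)
    fix y assume y: "y \<in> mweight V (W (conj_by k g)) \<rho>"
    then have "y \<in> \<Phi> g k ` mspace (W g)" using img mweight_subset by blast
    then obtain w where "w \<in> mspace (W g)" "y = \<Phi> g k w" by blast
    with y eigen show "y \<in> \<Phi> g k ` mweight V (W g) \<rho>" by blast
  qed (use eigen mweight_subset in blast)
qed

lemma clinear_Phi_mweight:
  "g \<in> G \<Longrightarrow> k \<in> G \<Longrightarrow> clinear_on (mweight V (W g) \<rho>) (\<Phi> g k)"
  by (rule clinear_on_subset[OF clinear_Phi mweight_subset])

lemma Phi_centralizer_mweight:
  assumes "g \<in> G" "h \<in> centralizer G g"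
  shows "\<Phi> g h ` mweight V (W g) \<rho> \<subseteq> mweight V (W g) \<rho>"
proof -
  have "h \<in> G" using assms(2) by (simp add: centralizer_def)
  then show ?thesis
    using bij_Phi_mweight[of g h \<rho>] assms conj_centralizer[OF assms] by (simp add: bij_betw_def)
qed

text \<open>\<open>\<Phi> g k\<close> intertwines the two operators: by the composition law both
  composites are the action of \<open>k \<circ> h = conj_by k h \<circ> k\<close>. Conjugate
  endomorphisms have the same trace.\<close>

lemma ctrace_conj:
  assumes k: "k \<in> G" and g: "g \<in> G" and h: "h \<in> centralizer G g"
  shows "ctrace (mweight V (W (conj_by k g)) \<rho>) (\<Phi> (conj_by k g) (conj_by k h))
    = ctrace (mweight V (W g) \<rho>) (\<Phi> g h)"
proof (rule ctrace_conjugate)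
  have hG: "h \<in> G" using h by (simp add: centralizer_def)
  have kg: "conj_by k g \<in> G" and kh: "conj_by k h \<in> G"
    using conj_in k g hG by blast+
  have khc: "conj_by k h \<in> centralizer G (conj_by k g)"
    using bij_betw_conj_centralizer[OF k g] h by (auto simp: bij_betw_def)
  show "clinear_on (mweight V (W g) \<rho>) (\<Phi> g h)" by (rule clinear_Phi_mweight[OF g hG])
  show "clinear_on (mweight V (W (conj_by k g)) \<rho>) (\<Phi> (conj_by k g) (conj_by k h))"
    by (rule clinear_Phi_mweight[OF kg kh])
  show "\<Phi> g h ` mweight V (W g) \<rho> \<subseteq> mweight V (W g) \<rho>"
    by (rule Phi_centralizer_mweight[OF g h])
  show "\<Phi> (conj_by k g) (conj_by k h) ` mweight V (W (conj_by k g)) \<rho>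
      \<subseteq> mweight V (W (conj_by k g)) \<rho>"
    by (rule Phi_centralizer_mweight[OF kg khc])
  show "clinear_on (mweight V (W g) \<rho>) (\<Phi> g k)" by (rule clinear_Phi_mweight[OF g k])
  show "bij_betw (\<Phi> g k) (mweight V (W g) \<rho>) (mweight V (W (conj_by k g)) \<rho>)"
    by (rule bij_Phi_mweight[OF g k])
  have "k \<circ> h = conj_by k h \<circ> k" using conj_by_eq_iff[OF bij[OF k]] by blast
  then show "\<Phi> (conj_by k g) (conj_by k h) (\<Phi> g k x) = \<Phi> g k (\<Phi> g h x)"
    if "x \<in> mweight V (W g) \<rho>" for x
    using Phi_comp[OF g k kh, of x] Phi_comp[OF g hG k, of x] subsetD[OF mweight_subset that]
      conj_centralizer[OF g h] by simp
qed (use subspace_mweight finite_dim_mweight conj_in k g in auto)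

text \<open>The two series agree term by term.\<close>

lemma twining_character_conj:
  assumes "k \<in> G" "g \<in> G" "h \<in> centralizer G g"
  shows "twining_character V W \<Phi> (conj_by k g) (conj_by k h) \<tau> = twining_character V W \<Phi> g h \<tau>"
  unfolding twining_character_def by (simp add: ctrace_conj[OF assms])

text \<open>In each sector the dimension of the invariants is the average of the traces over the
  centralizer in \<open>H\<close>; the sectors are then summed over class representatives.\<close>

lemma dim_orbifold_weight:
  assumes H: "subgroup H (Aut_group V)" "H \<subseteq> G"
  shows "of_nat (cvec.dim (orbifold_weight V W \<Phi> H \<rho>))
    = class_average (\<lambda>g h. ctrace (mweight V (W g) \<rho>) (\<Phi> g h)) H"
proof -
  interpret H: finite_bijection_group H
    by (rule finite_bijection_group_subgroup[OF H(1) finite_subset[OF H(2) finite_G]])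
  define F where "F g = {w \<in> mweight V (W g) \<rho>. \<forall>h\<in>centralizer H g. \<Phi> g h w = w}" for g
  have invariants: "cvec.subspace (F g) \<and> of_nat (cvec.dim (F g))
      = 1 / of_nat (card (centralizer H g)) *
        (\<Sum>h\<in>centralizer H g. ctrace (mweight V (W g) \<rho>) (\<Phi> g h))" if gH: "g \<in> H" for g
  proof -
    have g: "g \<in> G" using gH H(2) by blast
    have cG: "centralizer H g \<subseteq> centralizer G g" "centralizer H g \<subseteq> G"
      using H(2) by (auto simp: centralizer_def)
    \<comment> \<open>This supplies the left translations for the averaging argument; the inverse of
      \<open>l\<close> stays in the centralizer.\<close>
    have bij_mult: "bij_betw ((\<circ>) l) (centralizer H g) (centralizer H g)"
      if l: "l \<in> centralizer H g" for l
    proof -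
      have lH: "l \<in> H" and lg: "l \<circ> g = g \<circ> l" using l by (auto simp: centralizer_def)
      have closed: "x \<circ> y \<in> centralizer H g" if "x \<in> centralizer H g" "y \<in> centralizer H g" for x y
        using that by (auto simp: centralizer_def H.comp fun_eq_iff)
      have "conj_by l g = g" using lg H.bij[OF lH] by (simp add: conj_by_eq_iff)
      then have "conj_by (inv_into UNIV l) g = g" using H.conj_inv[OF lH, of g] by simp
      then have "inv_into UNIV l \<in> centralizer H g"
        using H.inv[OF lH] H.bij[OF H.inv[OF lH]] by (simp add: centralizer_def conj_by_eq_iff)
      then show ?thesis
        by (intro bij_betw_byWitness[where f' = "(\<circ>) (inv_into UNIV l)"])
          (use closed l H.inv_comp[OF lH] in \<open>auto simp: comp_assoc[symmetric]\<close>)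
    qed
    have Phi_mult: "\<Phi> g l (\<Phi> g h x) = \<Phi> g (l \<circ> h) x"
      if "l \<in> centralizer H g" "h \<in> centralizer H g" "x \<in> mweight V (W g) \<rho>" for l h x
    proof -
      have "l \<in> G" "h \<in> G" "h \<in> centralizer G g" using that(1,2) cG by auto
      then show ?thesis
        using Phi_comp[OF g, of h l x] conj_centralizer[OF g, of h] subsetD[OF mweight_subset that(3)]
        by simp
    qed
    have "finite (centralizer H g)" "centralizer H g \<noteq> {}"
      using H.fin H.id by (auto simp: centralizer_def)
    note inv = dim_invariants[OF subspace_mweight[OF g] finite_dim_mweight[OF g] this,
        where R = "\<Phi> g" and m = "(\<circ>)"]
    have lin: "clinear_on (mweight V (W g) \<rho>) (\<Phi> g h)"
      and img: "\<Phi> g h ` mweight V (W g) \<rho> \<subseteq> mweight V (W g) \<rho>" if "h \<in> centralizer H g" for h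
      using that cG clinear_Phi_mweight[OF g] Phi_centralizer_mweight[OF g] by blast+
    show ?thesis
      unfolding F_def using inv[OF lin img bij_mult Phi_mult] by blast
  qed
  have reps: "class_reps H \<subseteq> H" by (rule H.class_reps_subset)
  have "orbifold_weight V W \<Phi> H \<rho>
      = {x. (\<forall>g\<in>class_reps H. x g \<in> F g) \<and> (\<forall>g. g \<notin> class_reps H \<longrightarrow> x g = 0)}"
    by (auto simp: orbifold_weight_def orbifold_space_def F_def mweight_def)
  also have "cvec.dim \<dots> = (\<Sum>g\<in>class_reps H. cvec.dim (F g))"
  proof (rule dim_families)
    show "finite (class_reps H)" using reps H.fin by (rule finite_subset)
    fix g assume "g \<in> class_reps H"
    then have g: "g \<in> H" "g \<in> G" using reps H(2) by auto
    show "cvec.subspace (F g)" using invariants g by blast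
    show "finite_dim (F g)"
      by (rule finite_dim_subset[OF finite_dim_mweight[OF g(2)]]) (auto simp: F_def)
  qed
  finally have "of_nat (cvec.dim (orbifold_weight V W \<Phi> H \<rho>))
      = (\<Sum>g\<in>class_reps H. of_nat (cvec.dim (F g)) :: complex)" by simp
  also have "\<dots> = class_average (\<lambda>g h. ctrace (mweight V (W g) \<rho>) (\<Phi> g h)) H"
    unfolding class_average_def using invariants reps by (intro sum.cong refl) blast
  finally show ?thesis .
qed

lemma orbifold_character_eq:
  "orbifold_character V W \<Phi> H \<tau> = class_average (\<lambda>g h. twining_character V W \<Phi> g h \<tau>) H"
  by (simp add: orbifold_character_def class_average_def)

end

text \<open>The infinite sum in a twining character defaults to 0 where it does not converge. The
  second conjunct therefore also asserts the identity for each graded dimension of the orbifold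
  spaces themselves.\<close>

theorem theorem3p9:
  fixes V :: "'v::complex_vector voa"
    and W :: "('v \<Rightarrow> 'v) \<Rightarrow> ('v, 'w::complex_vector) vmodule"
    and \<Phi> :: "('v \<Rightarrow> 'v) \<Rightarrow> ('v \<Rightarrow> 'v) \<Rightarrow> 'w \<Rightarrow> 'w"
    and I :: "('v \<Rightarrow> 'v) \<Rightarrow> ('v \<Rightarrow> 'v) \<Rightarrow> 'w \<Rightarrow> complex \<Rightarrow> 'w \<Rightarrow> 'w"
    and \<omega> :: "('v \<Rightarrow> 'v) \<Rightarrow> ('v \<Rightarrow> 'v) \<Rightarrow> ('v \<Rightarrow> 'v) \<Rightarrow> complex"
    and G :: "('v \<Rightarrow> 'v) set"
    and a A B :: "'v \<Rightarrow> 'v"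
    and \<iota> :: "int \<times> nat \<Rightarrow> 'v \<Rightarrow> 'v"
    and q p r :: nat and \<phi> :: int
  assumes q: "prime q" and p: "0 < p" "coprime p q"
    and phi: "\<not> [\<phi> = 1] (mod int q)" "[\<phi> ^ p = 1] (mod int q)"
    and r: "r = (LEAST d. d dvd p \<and> [\<phi> ^ d = 1] (mod int q))"
    and V: "tame V" "holomorphic_voa V"
    and G: "subgroup G (Aut_group V)"
    and iota: "\<iota> \<in> iso (semidirect q p \<phi>) ((Aut_group V)\<lparr>carrier := G\<rparr>)"
    and a: "a = \<iota> (1, 0)" and A: "A = \<iota> (0, 1)" and B: "B = A ^^ r"
    and W: "\<forall>g\<in>G. irreducible_twisted_module V g (W g)"
    and omega: "orbifold_cocycle V G W \<omega>" "trivial_class G \<omega>"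
    and normalization: "fusion_system V G W (\<lambda>_ _ _. 1) I" "twist_action G W \<Phi>"
      "braiding_normalized V G W I \<Phi>" "linear_action G W \<Phi>"
  shows "(\<forall>\<tau>. 0 < Im \<tau> \<longrightarrow>
      orbifold_character V W \<Phi> G \<tau> =
        orbifold_character V W \<Phi> (generate (Aut_group V) {A}) \<tau>
        - 1 / of_nat r *
          (orbifold_character V W \<Phi> (generate (Aut_group V) {B}) \<tau>
           - orbifold_character V W \<Phi> (generate (Aut_group V) {a \<circ> B}) \<tau>)) \<and>
    (\<forall>\<rho>.
      real (cvec.dim (orbifold_weight V W \<Phi> G \<rho>)) =
        real (cvec.dim (orbifold_weight V W \<Phi> (generate (Aut_group V) {A}) \<rho>))
        - 1 / real r *
          (real (cvec.dim (orbifold_weight V W \<Phi> (generate (Aut_group V) {B}) \<rho>))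
           - real (cvec.dim (orbifold_weight V W \<Phi> (generate (Aut_group V) {a \<circ> B}) \<rho>))))"
proof -
  have "bij_betw \<iota> ({0..<int q} \<times> {0..<p}) G"
    using iota by (simp add: iso_def semidirect_simps)
  then have finG: "finite G" using bij_betw_finite by blast
  interpret twisted_sectors V W \<Phi> G
    by (rule twisted_sectors.intro)
      (use G finG W normalization in \<open>auto simp: irreducible_twisted_module_def\<close>)
  note average = class_average_semidirect[OF q p phi r G iota a A B]
  have char: "orbifold_character V W \<Phi> G \<tau> =
      orbifold_character V W \<Phi> (generate (Aut_group V) {A}) \<tau>
      - 1 / of_nat r * (orbifold_character V W \<Phi> (generate (Aut_group V) {B}) \<tau>
        - orbifold_character V W \<Phi> (generate (Aut_group V) {a \<circ> B}) \<tau>)" for \<tau>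
    unfolding orbifold_character_eq by (rule average) (rule twining_character_conj)
  have gens: "generate (Aut_group V) {x} \<subseteq> G \<and> subgroup (generate (Aut_group V) {x}) (Aut_group V)"
    if "x \<in> G" for x
    using that group.generate_subgroup_incl[OF group_Aut_group _ G, of "{x}"]
      group.generate_is_subgroup[OF group_Aut_group, of "{x}"] subgroup.subset[OF G] by blast
  have q2: "2 \<le> q" using q prime_ge_2_nat by blast
  \<comment> \<open>Puts \<open>(0, 1)\<close> into the carrier, which \<iota> maps into
    \<open>G\<close>.\<close>
  have "p \<noteq> 1" using phi by auto
  then have mem: "a \<in> G" "A \<in> G"
    using iota q2 p(1) by (auto simp: a A iso_def hom_def semidirect_simps Pi_iff)
  have "A ^^ n \<in> G" for n
    using mem(2) id comp by (induction n) auto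
  then have mem': "B \<in> G" "a \<circ> B \<in> G" using mem comp by (auto simp: B)
  have dim: "real (cvec.dim (orbifold_weight V W \<Phi> G \<rho>)) =
      real (cvec.dim (orbifold_weight V W \<Phi> (generate (Aut_group V) {A}) \<rho>))
      - 1 / real r * (real (cvec.dim (orbifold_weight V W \<Phi> (generate (Aut_group V) {B}) \<rho>))
        - real (cvec.dim (orbifold_weight V W \<Phi> (generate (Aut_group V) {a \<circ> B}) \<rho>)))"
    (is "?x = ?y") for \<rho>
  proof -
    \<comment> \<open>Class averages are complex valued; the real identity is recovered because the
      embedding of the reals is injective.\<close>
    have "complex_of_real ?x = complex_of_real ?y"
      using average[of "\<lambda>g h. ctrace (mweight V (W g) \<rho>) (\<Phi> g h)", OF ctrace_conj]
        dim_orbifold_weight[of _ \<rho>] gens mem(2) mem' G by simp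
    then show ?thesis by (simp only: of_real_eq_iff)
  qed
  show ?thesis using char dim by blast
qed

end
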